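(* There exist instances of the Dial-a-Ride problem whose metric is a set of points in the Euclidean plane (with Euclidean distances), with $n$ demands, for which the length of an optimal non-preemptive tour is $\Omega\!\left(\frac{n^{1/8}}{\log^3 n}\right)$ times the length of an optimal preemptive tour.
   Context: Dial-a-Ride: given a metric $(V,d)$, a root $r$, demands $(s_i,t_i)$ and a vehicle capacity $k$, a tour starts and ends at $r$ and moves each object $i$ from $s_i$ to $t_i$ while carrying at most $k$ objects at any time; length is the sum of distances over traversed edges. A non-preemptive tour never drops an object anywhere other than its destination once it is picked up; a preemptive tour may drop objects at intermediate vertices and pick them up later, any number of times. *)

theory Defs
  imports "HOL-Analysis.Analysis" "HOL-Library.Landau_Symbols"
begin

text \<open>
  The metric is the set \<open>verts\<close> with the distance \<open>dist\<close> of the ambient metric space.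
  Demands form a list, so several objects may share source and destination; objects are
  numbered by their position in this list.
\<close>

record 'a dial_a_ride =
  verts :: "'a set"
  root :: 'a
  demands :: "('a \<times> 'a) list"
  capacity :: nat

definition valid_instance :: "'a dial_a_ride \<Rightarrow> bool" where
  "valid_instance I \<longleftrightarrow>
     finite (verts I) \<and> root I \<in> verts I \<and>
     set (demands I) \<subseteq> verts I \<times> verts I \<and> capacity I \<ge> 1"

datatype mode = Preemptive | Nonpreemptive

datatype 'a action = Travel 'a | PickUp nat | Drop nat

text \<open>
  A configuration consists of the position of the vehicle and, for each object, \<open>Some v\<close> if the
  object lies at \<open>v\<close> and \<open>None\<close> if it is aboard the vehicle.
\<close>

type_synonym 'a config = "'a \<times> 'a option list"

inductive route :: "mode \<Rightarrow> 'a dial_a_ride \<Rightarrow> 'a config \<Rightarrow> 'a action list \<Rightarrow> 'a config \<Rightarrow> bool"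
  for m :: mode and I :: "'a dial_a_ride" where
  route_Nil: "route m I c [] c"
| route_Travel:
    "\<lbrakk>v \<in> verts I; route m I (v, loc) as c\<rbrakk>
      \<Longrightarrow> route m I (u, loc) (Travel v # as) c"
| route_PickUp:
    "\<lbrakk>i < length loc; loc ! i = Some u; count_list loc None < capacity I;
      route m I (u, loc[i := None]) as c\<rbrakk>
      \<Longrightarrow> route m I (u, loc) (PickUp i # as) c"
| route_Drop:
    "\<lbrakk>i < length loc; loc ! i = None; m = Nonpreemptive \<longrightarrow> u = snd (demands I ! i);
      route m I (u, loc[i := Some u]) as c\<rbrakk>
      \<Longrightarrow> route m I (u, loc) (Drop i # as) c"

definition initial_config :: "'a dial_a_ride \<Rightarrow> 'a config" where
  "initial_config I = (root I, map (\<lambda>(s, t). Some s) (demands I))"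

definition final_config :: "'a dial_a_ride \<Rightarrow> 'a config" where
  "final_config I = (root I, map (\<lambda>(s, t). Some t) (demands I))"

definition tours :: "mode \<Rightarrow> 'a dial_a_ride \<Rightarrow> 'a action list set" where
  "tours m I = {as. route m I (initial_config I) as (final_config I)}"

fun route_length :: "'a::metric_space \<Rightarrow> 'a action list \<Rightarrow> real" where
  "route_length u [] = 0"
| "route_length u (Travel v # as) = dist u v + route_length v as"
| "route_length u (PickUp i # as) = route_length u as"
| "route_length u (Drop i # as) = route_length u as"

text \<open>
  For valid instances the infimum is a minimum, see \<open>opt_attained\<close> below.
\<close>

definition opt :: "mode \<Rightarrow> 'a::metric_space dial_a_ride \<Rightarrow> real" where
  "opt m I = (INF as\<in>tours m I. route_length (root I) as)"


lemma route_append: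
  "route m I c as c' \<Longrightarrow> route m I c' bs c'' \<Longrightarrow> route m I c (as @ bs) c''"
  by (induction rule: route.induct) (auto intro: route.intros)

lemma tours_nonempty:
  assumes "valid_instance I"
  shows "tours m I \<noteq> {}"
proof -
  let ?D = "demands I"
  let ?loc = "\<lambda>j. map (\<lambda>(s, t). Some t) (take j ?D) @ map (\<lambda>(s, t). Some s) (drop j ?D)"
  have "\<exists>as. route m I (root I, ?loc 0) as (root I, ?loc j)" if "j \<le> length ?D" for j
    using that
  proof (induction j)
    case 0
    show ?case by (blast intro: route.intros)
  next
    case (Suc j)
    then obtain as where as: "route m I (root I, ?loc 0) as (root I, ?loc j)" by auto
    obtain s t where st: "?D ! j = (s, t)" by fastforce
    have j: "j < length ?D" using Suc.prems by simp
    then have "(s, t) \<in> set ?D" using st by (metis nth_mem)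
    then have v: "s \<in> verts I" "t \<in> verts I" "root I \<in> verts I" and k: "0 < capacity I"
      using assms by (auto simp: valid_instance_def)
    have dr: "drop j ?D = (s, t) # drop (Suc j) ?D"
      using j st by (simp add: Cons_nth_drop_Suc[symmetric])
    have tk: "take (Suc j) ?D = take j ?D @ [(s, t)]"
      using j st by (simp add: take_Suc_conv_app_nth)
    have cnt: "count_list (?loc j) None = 0"
      by (auto simp: count_list_0_iff)
    have len: "length (?loc j) = length ?D" "j < length (?loc j)" using j by auto
    have nth: "?loc j ! j = Some s" using j by (simp add: nth_append dr)
    have upd: "(?loc j)[j := Some t] = ?loc (Suc j)"
      using j by (simp add: list_update_append dr tk)
    have "route m I (root I, ?loc j)
            [Travel s, PickUp j, Travel t, Drop j, Travel (root I)] (root I, ?loc (Suc j))"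
      using v k cnt len nth st upd j
      by (auto intro!: route.intros simp del: map_append)
    from route_append[OF as this] show ?case by blast
  qed
  from this[of "length ?D"] show ?thesis
    by (auto simp: tours_def initial_config_def final_config_def)
qed

lemma route_length_legs:
  assumes "route m I c as c'" "fst c \<in> V" "verts I \<subseteq> V"
  shows "\<exists>xs. set xs \<subseteq> (\<lambda>(u, v). dist u v) ` (V \<times> V) - {0} \<and>
           route_length (fst c) as = sum_list xs"
  using assms
proof (induction rule: route.induct)
  case (route_Nil c)
  show ?case by (rule exI[of _ "[]"]) simp
next
  case (route_Travel v loc as c u)
  then obtain xs where xs: "set xs \<subseteq> (\<lambda>(u, v). dist u v) ` (V \<times> V) - {0}"
    "route_length v as = sum_list xs" by auto
  show ?case
  proof (cases "u = v")
    case True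
    then show ?thesis using xs by auto
  next
    case False
    then show ?thesis using xs route_Travel by (intro exI[of _ "dist u v # xs"]) auto
  qed
qed auto

lemma opt_attained:
  assumes I: "valid_instance I"
  shows "\<exists>as\<in>tours m I. route_length (root I) as = opt m I \<and>
           (\<forall>bs\<in>tours m I. route_length (root I) as \<le> route_length (root I) bs)"
proof -
  let ?f = "route_length (root I)"
  define D where "D = (\<lambda>(u, v). dist u v) ` (verts I \<times> verts I) - {0}"
  have finD: "finite D" using I by (auto simp: D_def valid_instance_def)
  have pos: "x > 0" if "x \<in> D" for x using that by (auto simp: D_def)
  obtain d where d: "d > 0" "\<And>x. x \<in> D \<Longrightarrow> d \<le> x"
  proof (cases "D = {}")
    case True
    then show ?thesis using that[of 1] by auto
  next
    case False
    then show ?thesis using that[of "Min D"] finD pos by auto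
  qed
  have bound: "d * real (length xs) \<le> sum_list xs" if "set xs \<subseteq> D" for xs
    using that by (induction xs) (auto simp: algebra_simps intro: add_mono d)
  obtain as0 where as0: "as0 \<in> tours m I" using tours_nonempty[OF I] by blast
  define L where "L = {?f as |as. as \<in> tours m I \<and> ?f as \<le> ?f as0}"
  have "L \<subseteq> sum_list ` {xs. set xs \<subseteq> D \<and> length xs \<le> nat \<lfloor>?f as0 / d\<rfloor>}"
  proof
    fix l assume "l \<in> L"
    then obtain as where as: "as \<in> tours m I" "?f as \<le> ?f as0" "l = ?f as"
      by (auto simp: L_def)
    have "route m I (initial_config I) as (final_config I)" using as by (simp add: tours_def)
    from route_length_legs[OF this, of "verts I"] obtain xs where
      xs: "set xs \<subseteq> D" "?f as = sum_list xs"
      using I by (auto simp: D_def initial_config_def valid_instance_def)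
    have "d * real (length xs) \<le> ?f as0" using bound[OF xs(1)] xs(2) as(2) by simp
    then have "real (length xs) \<le> ?f as0 / d" using d(1) by (simp add: field_simps)
    then have "length xs \<le> nat \<lfloor>?f as0 / d\<rfloor>" by (simp add: le_nat_floor)
    then show "l \<in> sum_list ` {xs. set xs \<subseteq> D \<and> length xs \<le> nat \<lfloor>?f as0 / d\<rfloor>}"
      using xs as(3) by auto
  qed
  then have finL: "finite L"
    using finite_lists_length_le[OF finD] by (meson finite_imageI finite_subset)
  have neL: "L \<noteq> {}" using as0 by (auto simp: L_def)
  have "Min L \<in> L" using finL neL by (rule Min_in)
  then obtain as where as: "as \<in> tours m I" "?f as = Min L" "?f as \<le> ?f as0"
    by (auto simp: L_def)
  have min: "?f as \<le> ?f bs" if "bs \<in> tours m I" for bs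
  proof (cases "?f bs \<le> ?f as0")
    case True
    then have "?f bs \<in> L" using that by (auto simp: L_def)
    then show ?thesis using finL as(2) by simp
  next
    case False
    then show ?thesis using as(3) by simp
  qed
  have "opt m I = ?f as"
    unfolding opt_def using as(1) min by (intro cInf_eq_minimum) auto
  then show ?thesis using as(1) min by auto
qed

end

theory Submission
  imports Defs "HOL-Computational_Algebra.Primes" "HOL-Real_Asymp.Real_Asymp"
begin

text \<open>
  For a prime \<open>q\<close>, the demands are the \<open>q ^ 3\<close> incidences between the points and the non-vertical
  lines of the affine plane over the field with \<open>q\<close> elements, both laid out as a \<open>q\<close> by \<open>q\<close> grid
  of unit spacing, and the capacity is \<open>q\<^sup>2\<close>. A preemptive vehicle sorts the objects first within
  the rows and then within the columns, at cost \<open>O(q\<^sup>2)\<close>. A piece of a tour of length \<open>s\<close> visits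
  \<open>O(s)\<close> grid points, and by the incidence bound of Szemeredi--Trotter type for finite planes these
  determine at most \<open>q\<^sup>2\<close> demands if \<open>s\<close> is a small multiple of \<open>q powr (3/2)\<close>. Cutting a
  non-preemptive tour into such pieces, every object is aboard at a cut or is served within a piece,
  which accounts for \<open>O(q\<^sup>2)\<close> objects per piece; so there are at least about \<open>q\<close> pieces and the
  gap is of order \<open>sqrt q\<close>. Demands from the root to itself adjust the number of demands, for which
  it suffices that there is a prime between the fourth and the third root of \<open>n\<close>.
\<close>

subsection \<open>Primes between roots\<close>

text \<open>
  The numbers \<open>1 / (m * (n choose m))\<close> form the Leibniz triangle, in which each entry is the
  difference of one entry of the row above and its right neighbour.
\<close>

lemma Lcm_div_Leibniz_in_Ints:
  assumes "1 \<le> m" "m \<le> n" "n \<le> N"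
  shows "real (Lcm {1..N}) / (real m * real (n choose m)) \<in> \<int>"
  using assms
\<comment> \<open>Induction on the distance to the right edge \<open>m = n\<close>, where the entry
  is \<open>1 / n\<close> and \<open>n\<close> divides the Lcm. Both entries in the difference, at
  \<open>(m, n')\<close> and \<open>(Suc m, n)\<close>, are one step closer to that edge.\<close>
proof (induction "n - m" arbitrary: m n)
  case 0
  then have "m = n" by simp
  moreover have "n dvd Lcm {1..N}" using 0 by (intro dvd_Lcm) auto
  ultimately show ?case by (auto elim!: dvdE)
next
  case (Suc d)
  obtain n' where n: "n = Suc n'" using Suc by (cases n) auto
  have m: "1 \<le> m" "m \<le> n'" using Suc n by auto
  have a: "real (Lcm {1..N}) / (real m * real (n' choose m)) \<in> \<int>"
    using Suc n by (intro Suc.hyps(1)) auto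
  have b: "real (Lcm {1..N}) / (real (Suc m) * real (n choose Suc m)) \<in> \<int>"
    using Suc n by (intro Suc.hyps(1)) auto
  have e1: "real (Suc m) * real (n choose Suc m) = real n * real (n' choose m)"
    using Suc_times_binomial_eq[of n' m] by (metis n of_nat_mult mult.commute)
  have e2: "real (n - m) * real (n choose m) = real n * real (n' choose m)"
    using binomial_absorb_comp[of n m] n by (metis of_nat_mult diff_Suc_1)
  have pos: "real (n' choose m) > 0" "real (n choose m) > 0" "real n > 0" "real m > 0"
    using m n by auto
  have "1 / (real m * real (n choose m)) =
      1 / (real m * real (n' choose m)) - 1 / (real n * real (n' choose m))"
  proof -
    have "1 / (real m * real (n' choose m)) - 1 / (real n * real (n' choose m)) =
        (real n - real m) / (real m * (real n * real (n' choose m)))"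
      using pos by (simp add: divide_simps)
    also have "\<dots> = (real n - real m) / (real m * ((real n - real m) * real (n choose m)))"
      using e2 m n by (simp add: of_nat_diff)
    also have "\<dots> = 1 / (real m * real (n choose m))" using m n by (simp add: divide_simps)
    finally show ?thesis by simp
  qed
  then have "real (Lcm {1..N}) / (real m * real (n choose m)) =
     real (Lcm {1..N}) / (real m * real (n' choose m)) - real (Lcm {1..N}) / (real n * real (n' choose m))"
    by (metis mult.right_neutral right_diff_distrib times_divide_eq_right)
  then show ?case using a b unfolding e1 by (metis Ints_diff)
qed

text \<open>The quotient of the Lcm by \<open>m * (2 * m choose m)\<close> is a positive integer,
  hence at least 1, and the central binomial coefficient is at least \<open>2 ^ m\<close>.\<close>

lemma two_power_le_Lcm: "2 ^ m \<le> Lcm {1..2 * m :: nat}"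
proof (cases "m = 0")
  case False
  let ?L = "Lcm {1..2 * m :: nat}"
  have L: "?L > 0" by (intro Nat.gr0I) (auto simp: Lcm_0_iff)
  have c: "real (2 * m choose m) > 0" by simp
  have "real ?L / (real m * real (2 * m choose m)) \<in> \<int>"
    using False by (intro Lcm_div_Leibniz_in_Ints) auto
  moreover have "real ?L / (real m * real (2 * m choose m)) > 0" using L False by simp
  ultimately have "real ?L / (real m * real (2 * m choose m)) \<ge> 1"
    by (auto elim!: Ints_cases)
  then have "real ?L \<ge> real m * real (2 * m choose m)"
    using False c by (simp add: field_simps)
  then have "m * (2 * m choose m) \<le> ?L" by (metis of_nat_le_iff of_nat_mult)
  moreover have "2 ^ m \<le> 2 * m choose m"
  proof -
    have "(real (2 * m) / real m) ^ m \<le> real (2 * m choose m)"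
      by (rule binomial_ge_n_over_k_pow_k) simp
    then have "real (2 ^ m) \<le> real (2 * m choose m)" using False by simp
    then show ?thesis by (simp only: of_nat_le_iff)
  qed
  moreover have "2 * m choose m \<le> m * (2 * m choose m)" using False by simp
  ultimately show ?thesis by linarith
qed auto

text \<open>The full power of a prime in the Lcm already divides some \<open>i\<close> in
  \<open>{1..N}\<close>, so each factor of the prime factorization is at most \<open>N\<close>. With
  \<open>two_power_le_Lcm\<close> this yields a lower bound of Chebyshev type for the number of
  primes.\<close>

lemma Lcm_le_power_primes:
  fixes N :: nat
  assumes N: "N \<ge> 1"
  shows "Lcm {1..N} \<le> N ^ card {p. prime p \<and> p \<le> N}"
proof -
  let ?L = "Lcm {1..N}" and ?P = "{p. prime p \<and> p \<le> N}"
  have L: "?L \<noteq> 0" by (auto simp: Lcm_0_iff)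
  have finP: "finite ?P" by (rule finite_subset[of _ "{..N}"]) auto
  have pf: "p \<in> ?P \<and> p ^ multiplicity p ?L \<le> N" if "p \<in> prime_factors ?L" for p
  proof -
    have p: "prime p" using that by auto
    have "\<exists>i\<in>{1..N}. multiplicity p ?L \<le> multiplicity p i"
    proof (rule ccontr)
      define v where "v = multiplicity p ?L"
      assume "\<not> ?thesis"
      then have less: "multiplicity p i < v" if "i \<in> {1..N}" for i using that by (metis v_def not_le)
      then have v: "v > 0" using N by force
      obtain r where r: "?L = p ^ v * r" "\<not> p dvd r"
        using multiplicity_decompose'[OF L, of p] not_prime_unit[of p] p unfolding v_def by blast
      \<comment> \<open>This number is \<open>?L\<close> divided by \<open>p\<close>. It would still
        be a common multiple, which the least one excludes; the \<open>p\<close>-part and the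
        \<open>p\<close>-free part \<open>j\<close> of \<open>i\<close> are treated
        separately.\<close>
      have "i dvd p ^ (v - 1) * r" if "i \<in> {1..N}" for i
      proof -
        have i0: "i \<noteq> 0" using that by auto
        obtain j where j: "i = p ^ multiplicity p i * j" "\<not> p dvd j"
          using multiplicity_decompose'[OF i0, of p] not_prime_unit[of p] p by blast
        have "j dvd i" using j(1) by (metis dvd_triv_right)
        also have "i dvd ?L" using that by (rule dvd_Lcm)
        finally have "j dvd p ^ v * r" using r by simp
        moreover have "coprime j (p ^ v)" using j(2) p
          by (metis coprime_commute coprime_power_left_iff prime_imp_coprime)
        ultimately have "j dvd r" by (simp add: coprime_dvd_mult_right_iff)
        moreover have "p ^ multiplicity p i dvd p ^ (v - 1)"
          using less[OF that] by (intro le_imp_power_dvd) auto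
        ultimately show ?thesis using j(1) by (metis mult_dvd_mono)
      qed
      then have "?L dvd p ^ (v - 1) * r" by (intro Lcm_least) auto
      then have "p ^ v * r \<le> p ^ (v - 1) * r"
        using r L by (intro dvd_imp_le) (auto simp: prime_gt_0_nat p)
      moreover have "p ^ (v - 1) < p ^ v"
        using v prime_gt_1_nat[OF p] by (intro power_strict_increasing) auto
      moreover have "r > 0" using r L by (cases r) auto
      ultimately show False by simp
    qed
    then obtain i where i: "i \<in> {1..N}" "multiplicity p ?L \<le> multiplicity p i" by blast
    have "p ^ multiplicity p ?L dvd i" using i(2) by (rule multiplicity_dvd')
    then have le: "p ^ multiplicity p ?L \<le> N" using i(1) dvd_imp_le[of _ i] by fastforce
    have "multiplicity p ?L > 0" using that by (simp add: prime_factors_multiplicity)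
    then have "p \<le> p ^ multiplicity p ?L"
      using prime_gt_0_nat[OF p] self_le_power[of p] by (simp add: Suc_leI)
    then show ?thesis using le p by auto
  qed
  have "?L = (\<Prod>p\<in>prime_factors ?L. p ^ multiplicity p ?L)"
    using L by (simp add: prod_prime_factors)
  also have "\<dots> \<le> (\<Prod>p\<in>prime_factors ?L. N)" by (rule prod_mono) (meson pf zero_le)
  also have "\<dots> = N ^ card (prime_factors ?L)" by simp
  also have "\<dots> \<le> N ^ card ?P"
  proof (intro power_increasing card_mono finP)
    show "prime_factors ?L \<subseteq> ?P" using pf by blast
  qed (use N in simp)
  finally show ?thesis .
qed

text \<open>If there is no such prime, every prime up to the cube root of \<open>n\<close> is below
  the fourth root. Then fewer than about \<open>(2 * m) powr (3 / 4)\<close> primes lie below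
  \<open>2 * m\<close>, the cube root of \<open>n\<close> up to rounding, too few for
  \<open>2 ^ m\<close> to be at most \<open>(2 * m)\<close> to that number.\<close>

lemma eventually_prime_between_roots:
  "\<forall>\<^sub>F n in sequentially. \<exists>p. prime p \<and> p ^ 3 \<le> n \<and> n \<le> p ^ 4"
proof -
  have "\<forall>\<^sub>F x in at_top. ln (2 * x) * (2 * x + 2) powr (3 / 4) < x * ln (2::real)"
    by real_asymp
  then have "\<forall>\<^sub>F m in sequentially. ln (2 * real m) * (2 * real m + 2) powr (3 / 4) < real m * ln 2"
    by (rule eventually_compose_filterlim[OF _ filterlim_real_sequentially])
  then obtain M where M: "\<And>m. m \<ge> M \<Longrightarrow>
      ln (2 * real m) * (2 * real m + 2) powr (3 / 4) < real m * ln 2"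
    by (auto simp: eventually_sequentially)
  have "\<exists>p. prime p \<and> p ^ 3 \<le> n \<and> n \<le> p ^ 4" if n: "n \<ge> (2 * M + 2) ^ 3" for n :: nat
  proof (rule ccontr)
    assume no: "\<not> ?thesis"
    \<comment> \<open>Half of the cube root, since the Lcm bound is for even \<open>2 * m\<close>.
      Rounding puts the cube root between \<open>2 * m\<close> and \<open>2 * m + 2\<close>.\<close>
    define m where "m = nat \<lfloor>NthRoot.root 3 (real n)\<rfloor> div 2"
    have root: "NthRoot.root 3 (real n) \<ge> 2 * M + 2"
    proof -
      have "real (2 * M + 2) ^ 3 \<le> real n" using n by (metis of_nat_le_iff of_nat_power)
      then have "NthRoot.root 3 (real (2 * M + 2) ^ 3) \<le> NthRoot.root 3 (real n)"
        by (intro real_root_le_mono) auto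
      then show ?thesis by (simp only: real_root_power_cancel of_nat_0_le_iff zero_less_numeral)
    qed
    define t where "t = nat \<lfloor>NthRoot.root 3 (real n)\<rfloor>"
    have t: "real t \<le> NthRoot.root 3 n" "NthRoot.root 3 n < real t + 1" "t \<ge> 2 * M + 2"
      using root by (auto simp: t_def le_nat_floor)
    have m: "2 * m \<le> t" "t < 2 * m + 2" "m \<ge> M" "m \<ge> 1" using t(3) by (auto simp: m_def t_def)
    have low: "real (2 * m) \<le> NthRoot.root 3 n" "NthRoot.root 3 n \<le> 2 * real m + 2" using t m by linarith+
    have "p < (2 * real m + 2) powr (3 / 4)" if p: "prime p" "p \<le> 2 * m" for p
    proof -
      have "real p \<le> NthRoot.root 3 n" using p low by linarith
      then have "real p ^ 3 \<le> NthRoot.root 3 n ^ 3" by (intro power_mono) auto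
      then have "real p ^ 3 \<le> n" by simp
      then have "p ^ 3 \<le> n" by (metis of_nat_le_iff of_nat_power)
      then have "p ^ 4 < n" using no p(1) by (meson not_le)
      then have "real p ^ 4 < real n" by (metis of_nat_less_iff of_nat_power)
      also have "real n = NthRoot.root 3 n ^ 3" by simp
      also have "\<dots> \<le> (2 * real m + 2) ^ 3" using low by (intro power_mono) auto
      also have "\<dots> = ((2 * real m + 2) powr (3 / 4)) ^ 4"
        by (simp add: powr_powr flip: powr_numeral)
      finally show ?thesis by (rule power_less_imp_less_base) simp
    qed
    then have "{p. prime p \<and> p \<le> 2 * m} \<subseteq> {1..nat \<lfloor>(2 * real m + 2) powr (3 / 4)\<rfloor>}"
      by (auto simp: prime_gt_0_nat Suc_le_eq le_nat_floor less_imp_le)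
    then have "card {p. prime p \<and> p \<le> 2 * m} \<le> card {1..nat \<lfloor>(2 * real m + 2) powr (3 / 4)\<rfloor>}"
      by (rule card_mono[rotated]) simp
    then have pi: "real (card {p. prime p \<and> p \<le> 2 * m}) \<le> (2 * real m + 2) powr (3 / 4)"
      by (simp add: le_nat_iff) linarith
    have "2 ^ m \<le> (2 * m) ^ card {p. prime p \<and> p \<le> 2 * m}"
      using two_power_le_Lcm[of m] Lcm_le_power_primes[of "2 * m"] m by linarith
    then have "real (2 ^ m) \<le> real ((2 * m) ^ card {p. prime p \<and> p \<le> 2 * m})"
      by (rule of_nat_mono)
    then have "ln (2 ^ m) \<le> ln ((2 * real m) ^ card {p. prime p \<and> p \<le> 2 * m})"
      using m by simp
    then have "real m * ln 2 \<le> real (card {p. prime p \<and> p \<le> 2 * m}) * ln (2 * real m)"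
      using m ln_realpow[of 2 m] ln_realpow[of "2 * real m" "card {p. prime p \<and> p \<le> 2 * m}"]
      by (simp only: zero_less_numeral zero_less_mult_iff of_nat_0_less_iff)
    also have "\<dots> \<le> (2 * real m + 2) powr (3 / 4) * ln (2 * real m)"
      using pi m by (intro mult_right_mono) auto
    finally show False using M[OF m(3)] by (simp add: mult.commute)
  qed
  then show ?thesis unfolding eventually_sequentially by blast
qed

subsection \<open>Incidences in the affine plane\<close>

text \<open>Subtracting the congruences for two slopes gives
  \<open>q dvd (m - m') * (x - x')\<close>. As \<open>q\<close> is prime, the slopes agree or
  \<open>x = x'\<close>, and the latter forces \<open>y = y'\<close>.\<close>

lemma line_through_two_points:
  fixes q x y x' y' :: nat
  assumes q: "prime q" and "x < q" "x' < q" "y < q" "y' < q" and ne: "(x, y) \<noteq> (x', y')"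
  shows "card {m. m < q \<and> (y + m * x) mod q = (y' + m * x') mod q} \<le> 1"
    (is "card ?M \<le> 1")
proof -
  have "m = m'"
    if m: "m < q" "(y + m * x) mod q = (y' + m * x') mod q"
      and m': "m' < q" "(y + m' * x) mod q = (y' + m' * x') mod q" for m m'
  proof -
    have "int (y + m * x) mod int q = int (y' + m * x') mod int q"
      using m(2) by (metis zmod_int)
    then have d: "int q dvd int (y + m * x) - int (y' + m * x')"
      by (rule mod_eq_dvd_iff[THEN iffD1])
    have "int (y + m' * x) mod int q = int (y' + m' * x') mod int q"
      using m'(2) by (metis zmod_int)
    then have d': "int q dvd int (y + m' * x) - int (y' + m' * x')"
      by (rule mod_eq_dvd_iff[THEN iffD1])
    have "int q dvd (int m - int m') * (int x - int x')"
      using dvd_diff[OF d d'] by (simp add: algebra_simps)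
    then have "int q dvd int m - int m' \<or> int q dvd int x - int x'"
      using q by (simp add: prime_dvd_mult_iff)
    then show "m = m'"
    proof
      assume "int q dvd int m - int m'"
      then have "int m mod int q = int m' mod int q" by (simp add: mod_eq_dvd_iff)
      then show ?thesis using m m' by simp
    next
      assume "int q dvd int x - int x'"
      then have "int x mod int q = int x' mod int q" by (simp add: mod_eq_dvd_iff)
      then have x: "x = x'" using assms by simp
      then have "int q dvd int y - int y'" using d by simp
      then have "int y mod int q = int y' mod int q" by (simp add: mod_eq_dvd_iff)
      then have "y = y'" using assms by simp
      then show ?thesis using x ne by simp
    qed
  qed
  then have "\<forall>m\<in>?M. \<forall>m'\<in>?M. m = m'" by blast
  moreover have "finite ?M" by (rule finite_subset[of _ "{..<q}"]) auto
  ultimately show ?thesis unfolding One_nat_def by (rule card_le_Suc0_iff_eq[THEN iffD2, rotated])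
qed

text \<open>
  Two points lie on at most one common line, so the number of points of \<open>S\<close> on a random line has
  variance at most \<open>card S / q\<close>; the bound follows by Cauchy--Schwarz.
\<close>

lemma incidence_bound:
  fixes q :: nat
  assumes q: "prime q" and S: "S \<subseteq> {..<q} \<times> {..<q}" and T: "T \<subseteq> {..<q} \<times> {..<q}"
  defines "J \<equiv> {((x, y), m). (x, y) \<in> S \<and> (m, (y + m * x) mod q) \<in> T}"
  shows "real (card J) \<le> real (card S) * real (card T) / q
           + sqrt (real q * real (card S) * real (card T))"
proof -
  let ?Q = "{..<q} \<times> {..<q}"
  define on where "on = (\<lambda>p l. (snd p + fst l * fst p) mod q = (snd l::nat))"
  \<comment> \<open>\<open>h l\<close> is the number of points of \<open>S\<close> on the line
    \<open>l\<close>, and \<open>\<mu>\<close> is its mean over all \<open>q * q\<close> lines, by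
    \<open>h_sum\<close> below.\<close>
  define h where "h = (\<lambda>l. \<Sum>p\<in>S. of_bool (on p l) :: real)"
  define \<mu> where "\<mu> = real (card S) / q"
  have q0: "q > 0" using q prime_gt_0_nat by blast
  have finS: "finite S" and finT: "finite T" using S T by (meson finite_SigmaI finite_lessThan finite_subset)+
  \<comment> \<open>A point lies on exactly one line of each slope.\<close>
  have pencil: "(\<Sum>l\<in>?Q. of_bool (on p l) :: real) = q" if "p \<in> S" for p
  proof -
    have "(\<Sum>l\<in>?Q. of_bool (on p l) :: real) =
        (\<Sum>m<q. \<Sum>b<q. if b = (snd p + m * fst p) mod q then 1 else 0)"
      unfolding sum.cartesian_product by (intro sum.cong) (auto simp: on_def of_bool_def)
    also have "\<dots> = (\<Sum>m<q. 1)" using q0 by (intro sum.cong) auto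
    finally show ?thesis by simp
  qed
  have pair: "(\<Sum>l\<in>?Q. of_bool (on p l) * of_bool (on p' l) :: real) \<le> 1"
    if "p \<in> S" "p' \<in> S" "p \<noteq> p'" for p p'
  proof -
    have "(\<Sum>l\<in>?Q. of_bool (on p l) * of_bool (on p' l) :: real) =
        (\<Sum>m<q. \<Sum>b<q. if b = (snd p + m * fst p) mod q then
            of_bool ((snd p + m * fst p) mod q = (snd p' + m * fst p') mod q) else 0)"
      unfolding sum.cartesian_product by (intro sum.cong) (auto simp: on_def of_bool_def)
    also have "\<dots> = (\<Sum>m<q. of_bool ((snd p + m * fst p) mod q = (snd p' + m * fst p') mod q))"
      using q0 by (intro sum.cong) auto
    also have "\<dots> = real (card {m. m < q \<and> (snd p + m * fst p) mod q = (snd p' + m * fst p') mod q})"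
      by (simp add: of_bool_def sum.If_cases Int_def)
    also have "\<dots> \<le> 1"
    proof -
      have "fst p < q" "snd p < q" "fst p' < q" "snd p' < q" using that S by auto
      then show ?thesis
        using line_through_two_points[OF q, of "fst p" "fst p'" "snd p" "snd p'"] that(3)
        by (simp add: prod_eq_iff)
    qed
    finally show ?thesis .
  qed
  have h_sum: "(\<Sum>l\<in>?Q. h l) = card S * q"
  proof -
    have "(\<Sum>l\<in>?Q. h l) = (\<Sum>p\<in>S. real q)"
      unfolding h_def by (subst sum.swap, rule sum.cong[OF refl], rule pencil)
    then show ?thesis by simp
  qed
  \<comment> \<open>Second moment of \<open>h\<close> by counting pairs of points: equal pairs share
    \<open>q\<close> lines, distinct ones at most one. Adding 1 for the equal pairs too makes the
    total exactly \<open>card S * q\<close> plus the square of \<open>card S\<close>.\<close>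
  let ?F = "\<lambda>l p p'. of_bool (on p l) * of_bool (on p' l) :: real"
  have sq1: "(\<Sum>l\<in>?Q. (h l)\<^sup>2) = (\<Sum>l\<in>?Q. \<Sum>p\<in>S. \<Sum>p'\<in>S. ?F l p p')"
    unfolding h_def power2_eq_square sum_product ..
  have sq2: "(\<Sum>l\<in>?Q. \<Sum>p\<in>S. \<Sum>p'\<in>S. ?F l p p') = (\<Sum>p\<in>S. \<Sum>l\<in>?Q. \<Sum>p'\<in>S. ?F l p p')" by (rule sum.swap)
  have sq3: "(\<Sum>p\<in>S. \<Sum>l\<in>?Q. \<Sum>p'\<in>S. ?F l p p') = (\<Sum>p\<in>S. \<Sum>p'\<in>S. \<Sum>l\<in>?Q. ?F l p p')"
    by (rule sum.cong[OF refl], rule sum.swap)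
  have sq4: "(\<Sum>p\<in>S. \<Sum>p'\<in>S. \<Sum>l\<in>?Q. ?F l p p') \<le> (\<Sum>p\<in>S. \<Sum>p'\<in>S. (if p = p' then real q else 0) + 1)"
  proof (rule sum_mono, rule sum_mono)
    fix p p' assume p: "p \<in> S" "p' \<in> S"
    show "(\<Sum>l\<in>?Q. of_bool (on p l) * of_bool (on p' l) :: real) \<le> (if p = p' then real q else 0) + 1"
    proof (cases "p = p'")
      case True
      have "?F l p p' = of_bool (on p l)" for l using True by simp
      then show ?thesis using pencil[OF p(1)] True by (simp only: if_True) simp
    next
      case False
      then show ?thesis using pair[OF p] by (simp only: if_False) simp
    qed
  qed
  have sq5: "(\<Sum>p\<in>S. \<Sum>p'\<in>S. (if p = p' then real q else 0) + 1) = card S * q + (card S)\<^sup>2"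
    using finS by (simp add: sum.distrib power2_eq_square distrib_left)
  have h_sq: "(\<Sum>l\<in>?Q. (h l)\<^sup>2) \<le> card S * q + (card S)\<^sup>2"
    using sq4 unfolding sq1 sq2 sq3 sq5 .
  have "(\<Sum>l\<in>?Q. (h l - \<mu>)\<^sup>2) = (\<Sum>l\<in>?Q. (h l)\<^sup>2) - 2 * \<mu> * (\<Sum>l\<in>?Q. h l) + q\<^sup>2 * \<mu>\<^sup>2"
  proof -
    have "(\<Sum>l\<in>?Q. (h l - \<mu>)\<^sup>2) = (\<Sum>l\<in>?Q. (h l)\<^sup>2 - 2 * \<mu> * h l + \<mu>\<^sup>2)"
      by (rule sum.cong) (simp_all add: power2_diff)
    also have "\<dots> = (\<Sum>l\<in>?Q. (h l)\<^sup>2) - (\<Sum>l\<in>?Q. 2 * \<mu> * h l) + (\<Sum>l\<in>?Q. \<mu>\<^sup>2)"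
      by (simp only: sum.distrib sum_subtractf)
    also have "(\<Sum>l\<in>?Q. 2 * \<mu> * h l) = 2 * \<mu> * (\<Sum>l\<in>?Q. h l)" by (rule sum_distrib_left[symmetric])
    also have "(\<Sum>l\<in>?Q. \<mu>\<^sup>2) = q\<^sup>2 * \<mu>\<^sup>2"
      by (simp only: sum_constant card_cartesian_product card_lessThan power2_eq_square of_nat_mult)
    finally show ?thesis .
  qed
  \<comment> \<open>The two terms with \<open>\<mu>\<close> add up to minus the square of
    \<open>card S\<close>, which cancels the contribution of the distinct pairs.\<close>
  also have "\<dots> \<le> card S * q"
    using h_sq q0 by (simp add: h_sum \<mu>_def power2_eq_square field_simps)
  finally have var: "(\<Sum>l\<in>?Q. (h l - \<mu>)\<^sup>2) \<le> card S * q" .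
  have "real (card J) = (\<Sum>l\<in>T. h l)"
  proof -
    \<comment> \<open>The same incidences, grouped by line instead of by point and slope.\<close>
    have "bij_betw (\<lambda>(p, m). ((m, (snd p + m * fst p) mod q), p)) J (Sigma T (\<lambda>l. {p\<in>S. on p l}))"
      by (rule bij_betwI[where g = "\<lambda>(l, p). (p, fst l)"]) (auto simp: J_def on_def)
    then have "card J = card (Sigma T (\<lambda>l. {p\<in>S. on p l}))" by (rule bij_betw_same_card)
    also have "\<dots> = (\<Sum>l\<in>T. card {p\<in>S. on p l})" using finS finT by (subst card_SigmaI) auto
    finally show ?thesis using finS by (simp add: h_def of_bool_def sum.If_cases Int_def)
  qed
  also have "\<dots> = \<mu> * card T + (\<Sum>l\<in>T. h l - \<mu>)" by (simp add: sum_subtractf)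
  also have "(\<Sum>l\<in>T. h l - \<mu>) \<le> sqrt (real q * real (card S) * real (card T))"
  proof (rule real_le_rsqrt)
    have "(\<Sum>l\<in>T. h l - \<mu>)\<^sup>2 \<le> (\<Sum>l\<in>T. (h l - \<mu>)\<^sup>2) * card T"
      using Cauchy_Schwarz_ineq_sum[of "\<lambda>l. h l - \<mu>" "\<lambda>_. 1" T] by simp
    moreover have "(\<Sum>l\<in>T. (h l - \<mu>)\<^sup>2) \<le> (\<Sum>l\<in>?Q. (h l - \<mu>)\<^sup>2)"
      using T by (intro sum_mono2) auto
    then have "(\<Sum>l\<in>T. (h l - \<mu>)\<^sup>2) * card T \<le> (card S * q) * real (card T)"
      using var by (intro mult_right_mono) auto
    ultimately show "(\<Sum>l\<in>T. h l - \<mu>)\<^sup>2 \<le> real q * real (card S) * real (card T)"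
      by (simp add: mult_ac)
  qed
  finally show ?thesis by (simp add: \<mu>_def)
qed

subsection \<open>Lengths of routes\<close>

lemma length_config_route: "route m I c as c' \<Longrightarrow> length (snd c') = length (snd c)"
  by (induction rule: route.induct) auto

lemma route_length_append:
  assumes "route m I (u, loc) as (v, loc')"
  shows "route_length u (as @ bs) = route_length u as + route_length v bs"
proof -
  have "route m I c as c' \<Longrightarrow>
      route_length (fst c) (as @ bs) = route_length (fst c) as + route_length (fst c') bs" for c c'
    by (induction rule: route.induct) auto
  from this[OF assms] show ?thesis by simp
qed

lemma final_vertex: "route m I c as c' \<Longrightarrow> fst c \<in> verts I \<Longrightarrow> fst c' \<in> verts I"
  by (induction rule: route.induct) auto

lemma route_split:
  "route m I c (as @ bs) c' \<Longrightarrow> \<exists>c''. route m I c as c'' \<and> route m I c'' bs c'"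
proof (induction as arbitrary: c)
  case Nil
  then show ?case by (intro exI[of _ c]) (simp add: route_Nil)
next
  case (Cons a as)
  from Cons.prems have "route m I c (a # (as @ bs)) c'" by simp
  then show ?case
  proof cases
    case (route_Travel v loc u)
    then show ?thesis using Cons.IH[of "(v, loc)"] route.route_Travel[of v I m loc as _ u] by blast
  next
    case (route_PickUp i loc u)
    then show ?thesis
      using Cons.IH[of "(u, loc[i := None])"] route.route_PickUp[of i loc u I m as] by blast
  next
    case (route_Drop i loc u)
    then show ?thesis
      using Cons.IH[of "(u, loc[i := Some u])"] route.route_Drop[of i loc m u I as] by blast
  qed
qed

lemma route_length_nonneg: "0 \<le> route_length u as"
  by (induction u as rule: route_length.induct) auto

subsection \<open>Moving batches of objects preemptively\<close>

text \<open>The preemptive construction keeps location lists in the form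
  \<open>map f [0..<n]\<close>: list updates become function updates, and a whole batch is one
  conditional.\<close>

lemma list_update_map_upt: "(map f [0..<n])[i := x] = map (f(i := x)) [0..<n]"
  by (rule nth_equalityI) (auto simp: nth_list_update)

lemma count_list_conv_card: "count_list xs x = card {i. i < length xs \<and> xs ! i = x}"
  by (simp add: count_list_eq_length_filter length_filter_conv_card eq_commute[of x])

lemma count_None_map_upt: "count_list (map f [0..<n]) None = card {i. i < n \<and> f i = None}"
  by (simp add: count_list_conv_card cong: conj_cong)

lemma pickup_all:
  assumes "finite B" "B \<subseteq> {..<n}" "\<And>i. i \<in> B \<Longrightarrow> f i = Some u"
    and "card {i. i < n \<and> f i = None} + card B \<le> capacity I"
  shows "\<exists>as. route m I (u, map f [0..<n]) as
           (u, map (\<lambda>i. if i \<in> B then None else f i) [0..<n]) \<and> route_length u as = 0"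
  using assms
proof (induction B arbitrary: f rule: finite_induct)
  case empty
  show ?case by (rule exI[of _ "[]"]) (simp add: route_Nil)
next
  case (insert b B)
  let ?f = "f(b := None)"
  have "{i. i < n \<and> ?f i = None} = insert b {i. i < n \<and> f i = None}"
    using insert.prems(1) by auto
  moreover have "b \<notin> {i. i < n \<and> f i = None}" using insert.prems(2)[of b] by simp
  ultimately have card: "card {i. i < n \<and> ?f i = None} = Suc (card {i. i < n \<and> f i = None})"
    by simp
  have "\<exists>as. route m I (u, map ?f [0..<n]) as
      (u, map (\<lambda>i. if i \<in> B then None else ?f i) [0..<n]) \<and> route_length u as = 0"
    using insert.prems insert.hyps card by (intro insert.IH) auto
  then obtain as where as: "route_length u as = 0"
    "route m I (u, map ?f [0..<n]) as (u, map (\<lambda>i. if i \<in> B then None else ?f i) [0..<n])" by blast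
  have "route m I (u, map f [0..<n]) (PickUp b # as)
      (u, map (\<lambda>i. if i \<in> B then None else ?f i) [0..<n])"
    using insert.prems insert.hyps as(2)
    by (intro route_PickUp) (auto simp: count_None_map_upt list_update_map_upt)
  moreover have "(\<lambda>i. if i \<in> B then None else ?f i) = (\<lambda>i. if i \<in> insert b B then None else f i)"
    by auto
  ultimately show ?case using as(1) by (intro exI[of _ "PickUp b # as"]) simp
qed

lemma drop_all:
  assumes "finite B" "B \<subseteq> {..<n}" "\<And>i. i \<in> B \<Longrightarrow> f i = None"
  shows "\<exists>as. route Preemptive I (u, map f [0..<n]) as
           (u, map (\<lambda>i. if i \<in> B then Some u else f i) [0..<n]) \<and> route_length u as = 0"
  using assms
proof (induction B arbitrary: f rule: finite_induct)
  case empty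
  show ?case by (rule exI[of _ "[]"]) (simp add: route_Nil)
next
  case (insert b B)
  let ?f = "f(b := Some u)"
  have "\<exists>as. route Preemptive I (u, map ?f [0..<n]) as
      (u, map (\<lambda>i. if i \<in> B then Some u else ?f i) [0..<n]) \<and> route_length u as = 0"
    using insert.prems insert.hyps by (intro insert.IH) auto
  then obtain as where as: "route_length u as = 0"
    "route Preemptive I (u, map ?f [0..<n]) as
       (u, map (\<lambda>i. if i \<in> B then Some u else ?f i) [0..<n])" by blast
  have "route Preemptive I (u, map f [0..<n]) (Drop b # as)
      (u, map (\<lambda>i. if i \<in> B then Some u else ?f i) [0..<n])"
    using insert.prems insert.hyps as(2)
    by (intro route_Drop) (auto simp: list_update_map_upt)
  moreover have "(\<lambda>i. if i \<in> B then Some u else ?f i) = (\<lambda>i. if i \<in> insert b B then Some u else f i)"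
    by auto
  ultimately show ?case using as(1) by (intro exI[of _ "Drop b # as"]) simp
qed

text \<open>At each vertex of \<open>vs\<close> all objects of \<open>A\<close> lying there are
  picked up. Only objects of \<open>A\<close> are ever aboard, so the load stays within
  \<open>card A\<close>; the start \<open>u\<close> itself counts only if the walk returns to
  it.\<close>

lemma collect_along:
  assumes "set vs \<subseteq> verts I" "A \<subseteq> {..<n}" "card A \<le> capacity I"
    and "\<And>i. i < n \<Longrightarrow> f i = None \<Longrightarrow> i \<in> A"
  shows "\<exists>as. route m I (u, map f [0..<n]) as
           (last (u # vs), map (\<lambda>i. if i \<in> A \<and> f i \<in> Some ` set vs then None else f i) [0..<n]) \<and>
           route_length u as = route_length u (map Travel vs)"
  using assms
proof (induction vs arbitrary: f u)
  case Nil
  show ?case by (rule exI[of _ "[]"]) (simp add: route_Nil)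
next
  case (Cons v vs)
  define B where "B = {i \<in> A. f i = Some v}"
  define f' where "f' = (\<lambda>i. if i \<in> B then None else f i)"
  have finA: "finite A" using Cons.prems by (auto intro: finite_subset)
  have "card {i. i < n \<and> f i = None} + card B = card ({i. i < n \<and> f i = None} \<union> B)"
    using finA by (intro card_Un_disjoint[symmetric]) (auto simp: B_def)
  also have "\<dots> \<le> card A" using finA Cons.prems by (intro card_mono) (auto simp: B_def)
  finally have "card {i. i < n \<and> f i = None} + card B \<le> capacity I" using Cons.prems by simp
  then have "\<exists>as. route m I (v, map f [0..<n]) as (v, map f' [0..<n]) \<and> route_length v as = 0"
    unfolding f'_def using finA Cons.prems by (intro pickup_all) (auto simp: B_def)
  then obtain as where as: "route m I (v, map f [0..<n]) as (v, map f' [0..<n])"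
    "route_length v as = 0" by blast
  have "\<exists>bs. route m I (v, map f' [0..<n]) bs
      (last (v # vs), map (\<lambda>i. if i \<in> A \<and> f' i \<in> Some ` set vs then None else f' i) [0..<n]) \<and>
      route_length v bs = route_length v (map Travel vs)"
    using Cons.prems by (intro Cons.IH) (auto simp: f'_def B_def split: if_splits)
  then obtain bs where bs: "route m I (v, map f' [0..<n]) bs
      (last (v # vs), map (\<lambda>i. if i \<in> A \<and> f' i \<in> Some ` set vs then None else f' i) [0..<n])"
    "route_length v bs = route_length v (map Travel vs)" by blast
  have "(\<lambda>i. if i \<in> A \<and> f' i \<in> Some ` set vs then None else f' i) =
      (\<lambda>i. if i \<in> A \<and> f i \<in> Some ` set (v # vs) then None else f i)"
    by (auto simp: f'_def B_def fun_eq_iff)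
  moreover have "route m I (u, map f [0..<n]) (Travel v # as @ bs)
      (last (v # vs), map (\<lambda>i. if i \<in> A \<and> f' i \<in> Some ` set vs then None else f' i) [0..<n])"
    using Cons.prems route_append[OF as(1) bs(1)] by (intro route_Travel) auto
  ultimately show ?case
    using as bs by (intro exI[of _ "Travel v # as @ bs"]) (simp add: route_length_append[OF as(1)])
qed

text \<open>Here \<open>g i\<close> is any chosen drop-off vertex, not necessarily the destination
  of \<open>i\<close>, which is why the mode is \<open>Preemptive\<close>.\<close>

lemma deliver_along:
  assumes "set vs \<subseteq> verts I" "A \<subseteq> {..<n}"
  shows "\<exists>as. route Preemptive I (u, map f [0..<n]) as
           (last (u # vs), map (\<lambda>i. if i \<in> A \<and> f i = None \<and> g i \<in> set vs then Some (g i) else f i) [0..<n]) \<and>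
           route_length u as = route_length u (map Travel vs)"
  using assms
proof (induction vs arbitrary: f u)
  case Nil
  show ?case by (rule exI[of _ "[]"]) (simp add: route_Nil)
next
  case (Cons v vs)
  define B where "B = {i \<in> A. f i = None \<and> g i = v}"
  define f' where "f' = (\<lambda>i. if i \<in> B then Some v else f i)"
  have finA: "finite A" using Cons.prems by (auto intro: finite_subset)
  have "\<exists>as. route Preemptive I (v, map f [0..<n]) as (v, map f' [0..<n]) \<and> route_length v as = 0"
    unfolding f'_def using finA Cons.prems by (intro drop_all) (auto simp: B_def)
  then obtain as where as: "route Preemptive I (v, map f [0..<n]) as (v, map f' [0..<n])"
    "route_length v as = 0" by blast
  let ?f'' = "\<lambda>i. if i \<in> A \<and> f' i = None \<and> g i \<in> set vs then Some (g i) else f' i"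
  have "\<exists>bs. route Preemptive I (v, map f' [0..<n]) bs (last (v # vs), map ?f'' [0..<n]) \<and>
      route_length v bs = route_length v (map Travel vs)"
    using Cons.prems by (intro Cons.IH) auto
  then obtain bs where bs: "route Preemptive I (v, map f' [0..<n]) bs (last (v # vs), map ?f'' [0..<n])"
    "route_length v bs = route_length v (map Travel vs)" by blast
  have "?f'' = (\<lambda>i. if i \<in> A \<and> f i = None \<and> g i \<in> set (v # vs) then Some (g i) else f i)"
    by (auto simp: f'_def B_def fun_eq_iff)
  moreover have "route Preemptive I (u, map f [0..<n]) (Travel v # as @ bs)
      (last (v # vs), map ?f'' [0..<n])"
    using Cons.prems route_append[OF as(1) bs(1)] by (intro route_Travel) auto
  ultimately show ?case
    using as bs by (intro exI[of _ "Travel v # as @ bs"]) (simp add: route_length_append[OF as(1)])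
qed

text \<open>The walk \<open>vs\<close> is made twice, first collecting and then delivering.
  \<open>C\<close> bounds the walk from every start because the second pass begins where the first
  one ends.\<close>

lemma move_batch:
  assumes vs: "set vs \<subseteq> verts I" and A: "A \<subseteq> {..<n}" "card A \<le> capacity I"
    and "h ` A \<subseteq> set vs" "g ` A \<subseteq> set vs"
    and C: "\<And>u. u \<in> verts I \<Longrightarrow> route_length u (map Travel vs) \<le> C"
    and u: "u \<in> verts I"
  shows "\<exists>as w. route Preemptive I (u, map (\<lambda>i. Some (h i)) [0..<n]) as
           (w, map (\<lambda>i. Some (if i \<in> A then g i else h i)) [0..<n]) \<and>
           w \<in> verts I \<and> route_length u as \<le> 2 * C"
proof -
  let ?f = "\<lambda>i. if i \<in> A then None else Some (h i)"
  let ?w = "last (u # vs)"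
  have w: "?w \<in> verts I" using vs u last_in_set[of "u # vs"] by auto
  have "(\<lambda>i. if i \<in> A \<and> Some (h i) \<in> Some ` set vs then None else Some (h i)) = ?f"
    using assms by (auto simp: fun_eq_iff)
  then obtain as where as: "route Preemptive I (u, map (\<lambda>i. Some (h i)) [0..<n]) as (?w, map ?f [0..<n])"
    "route_length u as = route_length u (map Travel vs)"
    using collect_along[OF vs A, of "\<lambda>i. Some (h i)" Preemptive u] by auto
  have "(\<lambda>i. if i \<in> A \<and> ?f i = None \<and> g i \<in> set vs then Some (g i) else ?f i) =
      (\<lambda>i. Some (if i \<in> A then g i else h i))"
    using assms by (auto simp: fun_eq_iff)
  then obtain bs where bs: "route Preemptive I (?w, map ?f [0..<n]) bs
      (last (?w # vs), map (\<lambda>i. Some (if i \<in> A then g i else h i)) [0..<n])"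
    "route_length ?w bs = route_length ?w (map Travel vs)"
    using deliver_along[OF vs A(1), of ?w ?f g] by auto
  have "last (?w # vs) \<in> verts I" using vs w last_in_set[of "?w # vs"] by auto
  moreover have "route_length u (as @ bs) \<le> 2 * C"
    using route_length_append[OF as(1)] as(2) bs(2) C[OF u] C[OF w] by simp
  ultimately show ?thesis using route_append[OF as(1) bs(1)] by blast
qed

text \<open>The batches are moved one after another. Being disjoint, a later batch still lies at its
  places \<open>h i\<close> when its turn comes.\<close>

lemma move_batches:
  fixes I :: "'a::metric_space dial_a_ride"
  assumes vs: "\<And>j. j < J \<Longrightarrow> set (vs j) \<subseteq> verts I"
    and A: "\<And>j. j < J \<Longrightarrow> A j \<subseteq> {..<n}" "\<And>j. j < J \<Longrightarrow> card (A j) \<le> capacity I"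
      "\<And>i j. i < j \<Longrightarrow> j < J \<Longrightarrow> A i \<inter> A j = {}"
    and hg: "\<And>j. j < J \<Longrightarrow> h ` A j \<subseteq> set (vs j)" "\<And>j. j < J \<Longrightarrow> g ` A j \<subseteq> set (vs j)"
    and C: "\<And>j u. j < J \<Longrightarrow> u \<in> verts I \<Longrightarrow> route_length u (map Travel (vs j)) \<le> C"
    and u: "u \<in> verts I"
  shows "\<exists>as w. route Preemptive I (u, map (\<lambda>i. Some (h i)) [0..<n]) as
           (w, map (\<lambda>i. Some (if i \<in> (\<Union>j<J. A j) then g i else h i)) [0..<n]) \<and>
           w \<in> verts I \<and> route_length u as \<le> 2 * C * real J"
  using assms
proof (induction J)
  case 0
  then show ?case by (intro exI[of _ "[]"] exI[of _ u]) (simp add: route_Nil)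
next
  case (Suc J)
  let ?h = "\<lambda>i. if i \<in> (\<Union>j<J. A j) then g i else h i"
  have "\<exists>as w. route Preemptive I (u, map (\<lambda>i. Some (h i)) [0..<n]) as
      (w, map (\<lambda>i. Some (?h i)) [0..<n]) \<and> w \<in> verts I \<and> route_length u as \<le> 2 * C * real J"
    by (rule Suc.IH; rule Suc.prems; (assumption | simp))
  then obtain as w where as: "route Preemptive I (u, map (\<lambda>i. Some (h i)) [0..<n]) as
      (w, map (\<lambda>i. Some (?h i)) [0..<n])" "w \<in> verts I" "route_length u as \<le> 2 * C * real J"
    by blast
  have "?h i = h i" if "i \<in> A J" for i using that Suc.prems(4)[of _ J] by auto
  then have h': "?h ` A J \<subseteq> set (vs J)" using Suc.prems(5)[of J] by (auto simp: image_subset_iff)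
  have "\<exists>bs w'. route Preemptive I (w, map (\<lambda>i. Some (?h i)) [0..<n]) bs
      (w', map (\<lambda>i. Some (if i \<in> A J then g i else ?h i)) [0..<n]) \<and>
    w' \<in> verts I \<and> route_length w bs \<le> 2 * C"
    by (rule move_batch[where vs = "vs J"]; (fact | (rule Suc.prems; (assumption | simp))))
  then obtain bs w' where bs: "route Preemptive I (w, map (\<lambda>i. Some (?h i)) [0..<n]) bs
      (w', map (\<lambda>i. Some (if i \<in> A J then g i else ?h i)) [0..<n])"
    "w' \<in> verts I" "route_length w bs \<le> 2 * C"
    by blast
  have eq: "(\<lambda>i. Some (if i \<in> A J then g i else ?h i)) =
      (\<lambda>i. Some (if i \<in> (\<Union>j<Suc J. A j) then g i else h i))"
    by (auto simp: lessThan_Suc)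
  have "route_length u (as @ bs) \<le> 2 * C * real (Suc J)"
    using route_length_append[OF as(1)] as(3) bs(3) by (simp add: algebra_simps)
  then show ?case using route_append[OF as(1) bs(1)] bs(2) unfolding eq by blast
qed

subsection \<open>Objects transported within a stretch of a tour\<close>

definition visited :: "'a \<Rightarrow> 'a action list \<Rightarrow> 'a set" where
  "visited u as = insert u {v. Travel v \<in> set as}"

lemma visited_Nil [simp]: "visited u [] = {u}"
  and visited_Travel [simp]: "visited u (Travel v # as) = insert u (visited v as)"
  and visited_PickUp [simp]: "visited u (PickUp i # as) = visited u as"
  and visited_Drop [simp]: "visited u (Drop i # as) = visited u as"
  by (auto simp: visited_def)

lemma finite_visited [simp]: "finite (visited u as)"
proof -
  have "finite (Travel -` set as)" by (intro finite_vimageI) (auto simp: inj_def)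
  then show ?thesis by (simp add: visited_def vimage_def)
qed

text \<open>An object leaves \<open>a\<close> only by a \<open>PickUp\<close> with the vehicle at
  \<open>a\<close>. Dually, in \<open>target_visited\<close>, it comes to lie at \<open>b\<close>
  only by a \<open>Drop\<close> there.\<close>

lemma source_visited:
  "route m I c as c' \<Longrightarrow> i < length (snd c) \<Longrightarrow> snd c ! i = Some a \<Longrightarrow> snd c' ! i \<noteq> Some a
     \<Longrightarrow> a \<in> visited (fst c) as"
proof (induction rule: route.induct)
  case (route_PickUp j loc u as c)
  then show ?case by (cases "i = j") (auto simp: visited_def)
next
  case (route_Drop j loc u as c)
  then show ?case by (cases "i = j") auto
qed auto

lemma target_visited:
  "route m I c as c' \<Longrightarrow> i < length (snd c) \<Longrightarrow> snd c ! i \<noteq> Some b \<Longrightarrow> snd c' ! i = Some b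
     \<Longrightarrow> b \<in> visited (fst c) as"
proof (induction rule: route.induct)
  case (route_PickUp j loc u as c)
  then show ?case by (cases "i = j") auto
next
  case (route_Drop j loc u as c)
  then show ?case by (cases "i = j"; cases "b = u") (auto simp: visited_def)
qed auto

text \<open>The three states are closed under all actions, since a drop is possible only at the
  destination. This is where the lower bound exploits the ban on preemption.\<close>

lemma nonpreemptive_location:
  "route Nonpreemptive I c as c' \<Longrightarrow> i < length (snd c) \<Longrightarrow>
     snd c ! i \<in> {None, Some a, Some (snd (demands I ! i))} \<Longrightarrow>
     snd c' ! i \<in> {None, Some a, Some (snd (demands I ! i))}"
proof (induction rule: route.induct)
  case (route_PickUp j loc u as c)
  then show ?case by (cases "i = j") auto
next
  case (route_Drop j loc u as c)
  then show ?case by (cases "i = j") auto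
qed auto

lemma load_le_capacity:
  "route m I c as c' \<Longrightarrow> card {i. i < length (snd c) \<and> snd c ! i = None} \<le> capacity I \<Longrightarrow>
     card {i. i < length (snd c') \<and> snd c' ! i = None} \<le> capacity I"
proof (induction rule: route.induct)
  case (route_PickUp j loc u as c)
  have "card {i. i < length loc \<and> loc[j := None] ! i = None} \<le>
      card (insert j {i. i < length loc \<and> loc ! i = None})"
    by (intro card_mono) (auto simp: nth_list_update split: if_splits)
  also have "\<dots> \<le> Suc (card {i. i < length loc \<and> loc ! i = None})" by (rule card_insert_le_m1) auto
  also have "\<dots> \<le> capacity I"
    using route_PickUp.hyps by (simp add: count_list_conv_card)
  finally show ?case using route_PickUp.IH by simp
next
  case (route_Drop j loc u as c)
  have "card {i. i < length loc \<and> loc[j := Some u] ! i = None} \<le> card {i. i < length loc \<and> loc ! i = None}"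
    using route_Drop.hyps(1) by (intro card_mono) (auto simp: nth_list_update split: if_splits)
  then show ?case using route_Drop by simp
qed auto

lemma route_Travel_verts: "route m I c as c' \<Longrightarrow> Travel v \<in> set as \<Longrightarrow> v \<in> verts I"
  by (induction rule: route.induct) auto

text \<open>A move to a different vertex costs at least 1 and adds at most one vertex; a move to the
  current vertex is free but adds none. The extra 1 is the start.\<close>

lemma card_visited_le:
  assumes "u \<in> V" "\<And>v. Travel v \<in> set as \<Longrightarrow> v \<in> V"
    and "\<And>v w. v \<in> V \<Longrightarrow> w \<in> V \<Longrightarrow> v \<noteq> w \<Longrightarrow> 1 \<le> dist v w"
  shows "real (card (visited u as)) \<le> 1 + route_length u as"
  using assms
proof (induction u as rule: route_length.induct)
  case (2 u v as)
  have IH: "real (card (visited v as)) \<le> 1 + route_length v as" using 2 by auto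
  show ?case
  proof (cases "u = v")
    case True
    then have "u \<in> visited v as" by (simp add: visited_def)
    then show ?thesis using IH True by (simp add: insert_absorb)
  next
    case False
    then have "1 \<le> dist u v" using 2 by auto
    moreover have "real (card (insert u (visited v as))) \<le> 1 + real (card (visited v as))"
      by (simp add: card_insert_if)
    ultimately show ?thesis using IH by simp
  qed
qed auto

text \<open>Take the shortest prefix of length at least \<open>s\<close>. Without its last action it
  is shorter than \<open>s\<close>, so it visits at most \<open>s\<close> vertices, and that action
  adds at most one.\<close>

lemma prefix_of_length:
  assumes "u \<in> V" "\<And>v. Travel v \<in> set as \<Longrightarrow> v \<in> V"
    and "\<And>v w. v \<in> V \<Longrightarrow> w \<in> V \<Longrightarrow> v \<noteq> w \<Longrightarrow> 1 \<le> dist v w"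
    and s: "s \<ge> 1" "real s \<le> route_length u as"
  shows "\<exists>p r. as = p @ r \<and> p \<noteq> [] \<and> real s \<le> route_length u p \<and> card (visited u p) \<le> s + 1"
proof -
  define j where "j = (LEAST j. real s \<le> route_length u (take j as))"
  have j: "real s \<le> route_length u (take j as)"
    unfolding j_def by (rule LeastI[of _ "length as"]) (use s in simp)
  have j0: "j \<noteq> 0" using j s by (intro notI) simp
  have jl: "j \<le> length as" unfolding j_def by (rule Least_le) (use s in simp)
  have less: "route_length u (take (j - 1) as) < real s"
    using not_less_Least[of "j - 1" "\<lambda>j. real s \<le> route_length u (take j as)"] j0
    unfolding j_def[symmetric] by simp
  have "real (card (visited u (take (j - 1) as))) \<le> 1 + route_length u (take (j - 1) as)"
    using assms in_set_takeD by (intro card_visited_le[where V = V]) fast+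
  then have "card (visited u (take (j - 1) as)) \<le> s" using less by linarith
  moreover have "take j as = take (j - 1) as @ [as ! (j - 1)]"
    using j0 jl take_Suc_conv_app_nth[of "j - 1" as] by simp
  then have "\<exists>v. visited u (take j as) \<subseteq> insert v (visited u (take (j - 1) as))"
    by (cases "as ! (j - 1)") (auto simp: visited_def)
  then obtain v where "visited u (take j as) \<subseteq> insert v (visited u (take (j - 1) as))" by blast
  then have "card (visited u (take j as)) \<le> card (insert v (visited u (take (j - 1) as)))"
    by (intro card_mono) auto
  then have "card (visited u (take j as)) \<le> Suc (card (visited u (take (j - 1) as)))"
    using card_insert_le_m1 by (simp add: card_insert_if split: if_splits)
  ultimately have "card (visited u (take j as)) \<le> s + 1" by simp
  moreover have "take j as \<noteq> []" using j s by (intro notI) simp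
  ultimately show ?thesis using j by (intro exI[of _ "take j as"] exI[of _ "drop j as"]) simp
qed

text \<open>
  Cut the tour into stretches of length about \<open>s\<close>. An object is either aboard at one of the cuts,
  or its source and its destination are visited within one stretch.
\<close>

lemma card_transported_le:
  fixes I :: "'a::metric_space dial_a_ride" and E s :: nat
  assumes sep: "\<And>v w. v \<in> verts I \<Longrightarrow> w \<in> verts I \<Longrightarrow> v \<noteq> w \<Longrightarrow> 1 \<le> dist v w"
    and s: "s \<ge> 1"
    and E: "\<And>S. S \<subseteq> verts I \<Longrightarrow> card S \<le> s + 1 \<Longrightarrow>
              card {i \<in> X. fst (demands I ! i) \<in> S \<and> snd (demands I ! i) \<in> S} \<le> E"
    and X: "X \<subseteq> {..<n}" "\<And>i. i \<in> X \<Longrightarrow> fst (demands I ! i) \<noteq> snd (demands I ! i)"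
    and "route Nonpreemptive I (u, loc) as (u', loc')" "u \<in> verts I" "length loc = n"
      "card {i. i < length loc \<and> loc ! i = None} \<le> capacity I"
  shows "real (card {i \<in> X. loc ! i = Some (fst (demands I ! i)) \<and> loc' ! i = Some (snd (demands I ! i))})
           \<le> E + route_length u as / s * real (capacity I + E)"
  using assms(6-)
\<comment> \<open>Induction on the number of actions, which drops because the stretch cut off is
  nonempty.\<close>
proof (induction "length as" arbitrary: u loc as rule: less_induct)
  case less
  note route = less.prems(1) and u = less.prems(2) and len = less.prems(3)
  define W where "W = (\<lambda>loc loc'. {i \<in> X. loc ! i = Some (fst (demands I ! i)) \<and>
                          loc' ! i = Some (snd (demands I ! i))})"
  have finX: "finite X" using X by (auto intro: finite_subset)
  have verts: "v \<in> verts I" if "Travel v \<in> set as" for v using route_Travel_verts[OF route that] .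
  have W_le: "card (W loc loc1) \<le> E"
    if "route Nonpreemptive I (u, loc) p (w, loc1)" "card (visited u p) \<le> s + 1" for p w loc1
  proof -
    have "W loc loc1 \<subseteq> {i \<in> X. fst (demands I ! i) \<in> visited u p \<and> snd (demands I ! i) \<in> visited u p}"
    proof
      fix i assume i: "i \<in> W loc loc1"
      then have "i < length loc" "fst (demands I ! i) \<noteq> snd (demands I ! i)"
        using X len by (auto simp: W_def)
      then show "i \<in> {i \<in> X. fst (demands I ! i) \<in> visited u p \<and> snd (demands I ! i) \<in> visited u p}"
        using i source_visited[OF that(1), of i] target_visited[OF that(1), of i] by (auto simp: W_def)
    qed
    then have "card (W loc loc1) \<le> card \<dots>" using finX by (intro card_mono) auto
    also have "\<dots> \<le> E"
      using u route_Travel_verts[OF that(1)] that(2) by (intro E) (auto simp: visited_def)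
    finally show ?thesis .
  qed
  have "real (card (W loc loc')) \<le> E + route_length u as / s * real (capacity I + E)"
  proof (cases "real s \<le> route_length u as")
    \<comment> \<open>The final, short stretch accounts for the additive \<open>E\<close>.\<close>
    case False
    have "real (card (visited u as)) \<le> 1 + route_length u as"
      using u verts sep by (intro card_visited_le[where V = "verts I"]) auto
    then have "card (W loc loc') \<le> E" using False by (intro W_le[OF route]) linarith
    moreover have "0 \<le> route_length u as / s * real (capacity I + E)"
      by (intro mult_nonneg_nonneg divide_nonneg_nonneg route_length_nonneg) auto
    ultimately show ?thesis by linarith
  next
    case True
    obtain p r where p: "as = p @ r" "p \<noteq> []" "real s \<le> route_length u p" "card (visited u p) \<le> s + 1"
      using prefix_of_length[OF u verts sep s True] by blast
    obtain w loc1 where mid: "route Nonpreemptive I (u, loc) p (w, loc1)"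
      "route Nonpreemptive I (w, loc1) r (u', loc')"
      using route_split[OF route[unfolded p(1)]] by (metis surj_pair)
    have len1: "length loc1 = n" using length_config_route[OF mid(1)] len by simp
    let ?O = "{i. i < length loc1 \<and> loc1 ! i = None}"
    have O: "card ?O \<le> capacity I" using load_le_capacity[OF mid(1)] less.prems(4) by simp
    have w: "w \<in> verts I"
      using final_vertex[OF mid(1)] u by simp
    have r: "real (card (W loc1 loc')) \<le> E + route_length w r / s * real (capacity I + E)"
      unfolding W_def using p mid(2) w len1 O by (intro less.hyps) auto
    \<comment> \<open>At the cut an object is aboard, already delivered, or still at its source;
      these are the three sets.\<close>
    have "W loc loc' \<subseteq> ?O \<union> W loc loc1 \<union> W loc1 loc'"
    proof
      fix i assume i: "i \<in> W loc loc'"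
      then have "i < length loc" "loc ! i = Some (fst (demands I ! i))" using X len by (auto simp: W_def)
      then have "loc1 ! i \<in> {None, Some (fst (demands I ! i)), Some (snd (demands I ! i))}"
        using nonpreemptive_location[OF mid(1), of i "fst (demands I ! i)"] by simp
      then show "i \<in> ?O \<union> W loc loc1 \<union> W loc1 loc'"
        using i X len1 by (auto simp: W_def)
    qed
    then have "card (W loc loc') \<le> card (?O \<union> W loc loc1 \<union> W loc1 loc')"
      using finX by (intro card_mono) (auto simp: W_def)
    also have "\<dots> \<le> card ?O + card (W loc loc1) + card (W loc1 loc')"
      by (meson card_Un_le add_right_mono le_trans)
    finally have "real (card (W loc loc')) \<le> capacity I + E + card (W loc1 loc')"
      using O W_le[OF mid(1) p(4)] by linarith
    \<comment> \<open>A stretch of length at least \<open>s\<close> pays for a full vehicle and the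
      \<open>E\<close> objects served within it.\<close>
    moreover have "real (capacity I + E) \<le> route_length u p / s * real (capacity I + E)"
    proof -
      have "1 \<le> route_length u p / s" using p(3) s by simp
      then show ?thesis using mult_right_mono[of 1 "route_length u p / s" "real (capacity I + E)"] by simp
    qed
    moreover have "route_length u as / s * real (capacity I + E) =
        route_length u p / s * real (capacity I + E) + route_length w r / s * real (capacity I + E)"
      using p(1) route_length_append[OF mid(1), of r] by (simp add: add_divide_distrib distrib_right)
    ultimately show ?thesis using r by simp
  qed
  then show ?case by (simp add: W_def)
qed

subsection \<open>The grid instance\<close>

definition pt :: "nat \<Rightarrow> nat \<Rightarrow> real ^ 2" where
  "pt i j = vector [real i, real j]"

definition grid :: "nat \<Rightarrow> (real ^ 2) set" where
  "grid q = (\<lambda>(i, j). pt i j) ` ({..<2 * q} \<times> {..<q})"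

text \<open>
  The first \<open>q ^ 3\<close> objects \<open>i\<close> encode the triples \<open>(x, y, m)\<close> with
  \<open>i = x * q\<^sup>2 + y * q + m\<close>. Sources fill the left half of the grid and destinations the
  right half; object \<open>(x, y, m)\<close> goes from the point \<open>(x, y)\<close> to the line of slope \<open>- m\<close> through it,
  which is represented by \<open>m\<close> and its intercept.
\<close>

definition src :: "nat \<Rightarrow> nat \<Rightarrow> real ^ 2" where
  "src q i = pt (i div q\<^sup>2) (i div q mod q)"

text \<open>The transfer point of the preemptive tour: in the row of the source and in the column of
  the destination.\<close>

definition relay :: "nat \<Rightarrow> nat \<Rightarrow> real ^ 2" where
  "relay q i = pt (q + i mod q) (i div q mod q)"

definition dst :: "nat \<Rightarrow> nat \<Rightarrow> real ^ 2" where
  "dst q i = pt (q + i mod q) ((i div q mod q + i mod q * (i div q\<^sup>2)) mod q)"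

definition grid_instance :: "nat \<Rightarrow> nat \<Rightarrow> (real ^ 2) dial_a_ride" where
  "grid_instance q n = \<lparr>verts = grid q, root = pt 0 0,
     demands = map (\<lambda>i. if i < q ^ 3 then (src q i, dst q i) else (pt 0 0, pt 0 0)) [0..<n],
     capacity = q\<^sup>2\<rparr>"

lemma grid_instance_simps [simp]:
  "verts (grid_instance q n) = grid q" "dial_a_ride.root (grid_instance q n) = pt 0 0"
  "capacity (grid_instance q n) = q\<^sup>2" "length (demands (grid_instance q n)) = n"
  by (simp_all add: grid_instance_def)

lemma demands_grid_instance_nth:
  "i < n \<Longrightarrow> i < q ^ 3 \<Longrightarrow> demands (grid_instance q n) ! i = (src q i, dst q i)"
  by (simp add: grid_instance_def)

lemma dist_pt: "dist (pt i j) (pt i' j') = sqrt ((real i - real i')\<^sup>2 + (real j - real j')\<^sup>2)"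
  by (simp add: dist_vec_def L2_set_def sum_2 pt_def dist_real_def)

lemma dist_pt_le: "dist (pt i j) (pt i' j') \<le> \<bar>real i - real i'\<bar> + \<bar>real j - real j'\<bar>"
  unfolding dist_pt by (rule sqrt_sum_squares_le_sum_abs)

lemma dist_pt_ge: "dist (pt i j) (pt i' j') \<ge> \<bar>real i - real i'\<bar>"
  "dist (pt i j) (pt i' j') \<ge> \<bar>real j - real j'\<bar>"
  unfolding dist_pt by (auto intro: real_le_rsqrt)

lemma pt_eq_iff [simp]: "pt i j = pt i' j' \<longleftrightarrow> i = i' \<and> j = j'"
proof
  assume "pt i j = pt i' j'"
  then have "dist (pt i j) (pt i' j') = 0" by simp
  then have "\<bar>real i - real i'\<bar> \<le> 0" "\<bar>real j - real j'\<bar> \<le> 0"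
    using dist_pt_ge[of i i' j j'] dist_pt_ge(2)[of j j' i i'] by linarith+
  then show "i = i' \<and> j = j'" by simp
qed simp

lemma pt_in_grid: "i < 2 * q \<Longrightarrow> j < q \<Longrightarrow> pt i j \<in> grid q"
  by (auto simp: grid_def)

lemma dist_grid_ge_1:
  assumes "u \<in> grid q" "v \<in> grid q" "u \<noteq> v"
  shows "1 \<le> dist u v"
proof -
  obtain i j i' j' where uv: "u = pt i j" "v = pt i' j'" using assms by (auto simp: grid_def)
  then consider "i \<noteq> i'" | "j \<noteq> j'" using assms by auto
  then show ?thesis
  proof cases
    case 1
    then have "1 \<le> \<bar>real i - real i'\<bar>" by linarith
    then show ?thesis using dist_pt_ge(1)[of i i' j j'] uv by simp
  next
    case 2
    then have "1 \<le> \<bar>real j - real j'\<bar>" by linarith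
    then show ?thesis using dist_pt_ge(2)[of j j' i i'] uv by simp
  qed
qed

lemma dist_grid_le:
  assumes "u \<in> grid q" "v \<in> grid q"
  shows "dist u v \<le> 3 * real q"
proof -
  obtain i j i' j' where uv: "u = pt i j" "v = pt i' j'" "i < 2 * q" "i' < 2 * q" "j < q" "j' < q"
    using assms by (auto simp: grid_def)
  then have "\<bar>real i - real i'\<bar> \<le> 2 * real q" "\<bar>real j - real j'\<bar> \<le> real q" by linarith+
  then show ?thesis using dist_pt_le[of i j i' j'] uv by simp
qed

lemma route_length_chain_le:
  assumes "\<And>i. dist (f i) (f (Suc i)) \<le> 1"
  shows "route_length u (map Travel (map f [a..<a + k])) \<le> dist u (f a) + real k"
proof (induction k arbitrary: u a)
  case (Suc k)
  have "[a..<a + Suc k] = a # [Suc a..<Suc a + k]" by (simp add: upt_rec)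
  then show ?case using Suc.IH[of "f a" "Suc a"] assms[of a] by simp
qed simp

section \<open>Objects as three-digit numbers in base \<open>q\<close>, and the preemptive
  tour\<close>

lemma digits_eq_imp_eq:
  fixes i j q :: nat
  assumes "i div q\<^sup>2 = j div q\<^sup>2" "i div q mod q = j div q mod q" "i mod q = j mod q"
  shows "i = j"
proof -
  have "i div q div q = j div q div q"
    using assms(1) by (simp add: div_mult2_eq power2_eq_square)
  then have "i div q = j div q" using assms(2) by (metis div_mult_mod_eq)
  then show ?thesis using assms(3) by (metis div_mult_mod_eq)
qed

lemma top_digit_less: "i < q ^ 3 \<Longrightarrow> i div q\<^sup>2 < (q::nat)"
  by (intro less_mult_imp_div_less) (simp add: power2_eq_square power3_eq_cube mult_ac)

text \<open>Two digits remain free once one is fixed. The middle digit is the row of the source; in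
  \<open>card_last_digit_le\<close> the last digit is the column of the destination.\<close>

lemma card_middle_digit_le:
  fixes q :: nat
  assumes "q > 0"
  shows "card {i. i < q ^ 3 \<and> i div q mod q = y} \<le> q\<^sup>2"
proof -
  have "card {i. i < q ^ 3 \<and> i div q mod q = y} \<le> card ({..<q} \<times> {..<q})"
    using assms by (intro card_inj_on_le[of "\<lambda>i. (i div q\<^sup>2, i mod q)"])
      (auto simp: inj_on_def top_digit_less intro: digits_eq_imp_eq)
  then show ?thesis by (simp add: power2_eq_square)
qed

lemma card_last_digit_le:
  fixes q :: nat
  assumes "q > 0"
  shows "card {i. i < q ^ 3 \<and> i mod q = m} \<le> q\<^sup>2"
proof -
  have "card {i. i < q ^ 3 \<and> i mod q = m} \<le> card ({..<q} \<times> {..<q})"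
    using assms by (intro card_inj_on_le[of "\<lambda>i. (i div q\<^sup>2, i div q mod q)"])
      (auto simp: inj_on_def top_digit_less intro: digits_eq_imp_eq)
  then show ?thesis by (simp add: power2_eq_square)
qed

lemma src_in_grid: "q > 0 \<Longrightarrow> i < q ^ 3 \<Longrightarrow> src q i \<in> grid q"
  unfolding src_def using top_digit_less[of i q] by (intro pt_in_grid) auto

lemma dst_in_grid: "q > 0 \<Longrightarrow> dst q i \<in> grid q"
  unfolding dst_def using mod_less_divisor[of q i] by (intro pt_in_grid) (linarith, simp)

lemma valid_grid_instance:
  assumes "q > 0"
  shows "valid_instance (grid_instance q n)"
  using assms src_in_grid[of q] dst_in_grid[of q] pt_in_grid[of 0 q 0]
  by (auto simp: valid_instance_def grid_instance_def grid_def[of q])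

text \<open>
  All \<open>q\<^sup>2\<close> objects starting in a row fit into the vehicle, which distributes them along the row;
  then the \<open>q\<^sup>2\<close> objects with destination in a column all lie in that column.
\<close>

lemma opt_preemptive_le:
  assumes q: "q > 0" and n: "q ^ 3 \<le> n"
  shows "opt Preemptive (grid_instance q n) \<le> 23 * (real q)\<^sup>2"
proof -
  let ?I = "grid_instance q n"
  \<comment> \<open>The padding objects rest at the root throughout.\<close>
  let ?at = "\<lambda>p i. if i < q ^ 3 then p i else pt 0 0"
  define row where "row = (\<lambda>y. map (\<lambda>x. pt x y) [0..<2 * q])"
  define col where "col = (\<lambda>m. map (\<lambda>y. pt (q + m) y) [0..<q])"
  define R where "R = (\<lambda>y. {i. i < q ^ 3 \<and> i div q mod q = y})"
  define K where "K = (\<lambda>m. {i. i < q ^ 3 \<and> i mod q = m})"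
  have root: "pt 0 0 \<in> verts ?I" using q by (simp add: pt_in_grid)
  \<comment> \<open>At most \<open>3 * q\<close> to reach the row and \<open>2 * q\<close> to walk
    it; the same bound is used for the shorter columns.\<close>
  have row_le: "route_length u (map Travel (row y)) \<le> 5 * real q"
    if "y < q" "u \<in> verts ?I" for y u
  proof -
    have "dist (pt i y) (pt (Suc i) y) \<le> 1" for i using dist_pt_le[of i y "Suc i" y] by simp
    from route_length_chain_le[where f = "\<lambda>x. pt x y" and a = 0 and k = "2 * q", OF this]
    have "route_length u (map Travel (row y)) \<le> dist u (pt 0 y) + real (2 * q)"
      by (simp only: row_def add_0)
    then show ?thesis using dist_grid_le[of u q "pt 0 y"] that by (simp add: pt_in_grid)
  qed
  have col_le: "route_length u (map Travel (col m)) \<le> 5 * real q"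
    if "m < q" "u \<in> verts ?I" for m u
  proof -
    have "dist (pt (q + m) i) (pt (q + m) (Suc i)) \<le> 1" for i
      using dist_pt_le[of "q + m" i "q + m" "Suc i"] by simp
    from route_length_chain_le[where f = "\<lambda>y. pt (q + m) y" and a = 0 and k = q, OF this]
    have "route_length u (map Travel (col m)) \<le> dist u (pt (q + m) 0) + real q"
      by (simp only: col_def add_0)
    then show ?thesis using dist_grid_le[of u q "pt (q + m) 0"] that by (simp add: pt_in_grid)
  qed
  have m_less: "q + i mod q < 2 * q" for i using mod_less_divisor[of q i] q by linarith
  have UR: "i \<in> (\<Union>y<q. R y) \<longleftrightarrow> i < q ^ 3" and UK: "i \<in> (\<Union>m<q. K m) \<longleftrightarrow> i < q ^ 3" for i
    using q by (auto simp: R_def K_def)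
  have eqR: "(\<lambda>i. Some (if i \<in> (\<Union>y<q. R y) then relay q i else ?at (src q) i)) =
      (\<lambda>i. Some (?at (relay q) i))"
    unfolding UR by auto
  have "\<exists>as w. route Preemptive ?I (pt 0 0, map (\<lambda>i. Some (?at (src q) i)) [0..<n]) as
      (w, map (\<lambda>i. Some (if i \<in> (\<Union>y<q. R y) then relay q i else ?at (src q) i)) [0..<n]) \<and>
      w \<in> verts ?I \<and> route_length (pt 0 0) as \<le> 2 * (5 * real q) * real q"
  proof (rule move_batches[where vs = row])
    fix y assume y: "y < q"
    show "set (row y) \<subseteq> verts ?I" using y by (auto simp: row_def pt_in_grid)
    show "R y \<subseteq> {..<n}" using n by (auto simp: R_def)
    show "card (R y) \<le> capacity ?I" using card_middle_digit_le[OF q] by (simp add: R_def)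
    show "?at (src q) ` R y \<subseteq> set (row y)"
      using top_digit_less by (fastforce simp: R_def row_def src_def)
    show "relay q ` R y \<subseteq> set (row y)"
      using m_less by (auto simp: R_def row_def relay_def)
  qed (use row_le root in \<open>auto simp: R_def\<close>)
  then obtain as w where as: "w \<in> verts ?I" "route_length (pt 0 0) as \<le> 2 * (5 * real q) * real q"
    "route Preemptive ?I (pt 0 0, map (\<lambda>i. Some (?at (src q) i)) [0..<n]) as
      (w, map (\<lambda>i. Some (?at (relay q) i)) [0..<n])"
    unfolding eqR by blast
  have eqK: "(\<lambda>i. Some (if i \<in> (\<Union>m<q. K m) then dst q i else ?at (relay q) i)) =
      (\<lambda>i. Some (?at (dst q) i))"
    unfolding UK by auto
  have "\<exists>bs w'. route Preemptive ?I (w, map (\<lambda>i. Some (?at (relay q) i)) [0..<n]) bs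
      (w', map (\<lambda>i. Some (if i \<in> (\<Union>m<q. K m) then dst q i else ?at (relay q) i)) [0..<n]) \<and>
      w' \<in> verts ?I \<and> route_length w bs \<le> 2 * (5 * real q) * real q"
  proof (rule move_batches[where vs = col])
    fix m assume m: "m < q"
    show "set (col m) \<subseteq> verts ?I" using m by (auto simp: col_def pt_in_grid)
    show "K m \<subseteq> {..<n}" using n by (auto simp: K_def)
    show "card (K m) \<le> capacity ?I" using card_last_digit_le[OF q] by (simp add: K_def)
    show "?at (relay q) ` K m \<subseteq> set (col m)" using q by (auto simp: K_def col_def relay_def)
    show "dst q ` K m \<subseteq> set (col m)" using q by (auto simp: K_def col_def dst_def)
  qed (use col_le as(1) in \<open>auto simp: K_def\<close>)
  then obtain bs w' where bs: "w' \<in> verts ?I" "route_length w bs \<le> 2 * (5 * real q) * real q"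
    "route Preemptive ?I (w, map (\<lambda>i. Some (?at (relay q) i)) [0..<n]) bs
      (w', map (\<lambda>i. Some (?at (dst q) i)) [0..<n])"
    unfolding eqK by blast
  have cs: "route Preemptive ?I (w', map (\<lambda>i. Some (?at (dst q) i)) [0..<n]) [Travel (pt 0 0)]
      (pt 0 0, map (\<lambda>i. Some (?at (dst q) i)) [0..<n])"
    using root by (intro route.intros) 
  let ?tour = "as @ bs @ [Travel (pt 0 0)]"
  have "initial_config ?I = (pt 0 0, map (\<lambda>i. Some (?at (src q) i)) [0..<n])"
    "final_config ?I = (pt 0 0, map (\<lambda>i. Some (?at (dst q) i)) [0..<n])"
    by (auto simp: initial_config_def final_config_def grid_instance_def)
  then have "?tour \<in> tours Preemptive ?I"
    unfolding tours_def using route_append[OF as(3) route_append[OF bs(3) cs]] by simp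
  then have "opt Preemptive ?I \<le> route_length (pt 0 0) ?tour"
    using opt_attained[OF valid_grid_instance[OF q], of Preemptive n] by auto
  also have "\<dots> = route_length (pt 0 0) as + (route_length w bs + dist w' (pt 0 0))"
    using route_length_append[OF as(3)] route_length_append[OF bs(3)] by simp
  \<comment> \<open>Two phases of \<open>q\<close> batches at cost \<open>2 * 5 * q\<close> each,
    plus the return to the root.\<close>
  also have "\<dots> \<le> 20 * (real q)\<^sup>2 + 3 * real q"
    using as(2) bs(2) dist_grid_le[of w' q "pt 0 0"] bs(1) root by (simp add: power2_eq_square)
  also have "\<dots> \<le> 23 * (real q)\<^sup>2"
    using q by (simp add: power2_eq_square)
  finally show ?thesis .
qed

section \<open>Lower bounds for both optima\<close>

text \<open>The demands inside \<open>S\<close> are incidences between the points \<open>P\<close>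
  and the lines \<open>L\<close> that \<open>S\<close> contains, each at most
  \<open>q powr (3 / 2) / 2\<close> in number. The two terms of \<open>incidence_bound\<close> are
  then at most a quarter and a half of the square of \<open>q\<close>.\<close>

lemma card_demands_within_le:
  assumes q: "prime q" and S: "finite S" "4 * (card S)\<^sup>2 \<le> q ^ 3"
  shows "card {i. i < q ^ 3 \<and> src q i \<in> S \<and> dst q i \<in> S} \<le> q\<^sup>2"
proof -
  let ?Q = "{..<q} \<times> {..<q}"
  define P where "P = {(x, y). x < q \<and> y < q \<and> pt x y \<in> S}"
  define L where "L = {(m, b). m < q \<and> b < q \<and> pt (q + m) b \<in> S}"
  define J where "J = {((x, y), m). (x, y) \<in> P \<and> (m, (y + m * x) mod q) \<in> L}"
  have q0: "q > 0" using q by (rule prime_gt_0_nat)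
  have P: "card P \<le> card S"
    using S by (intro card_inj_on_le[of "\<lambda>(x, y). pt x y"]) (auto simp: P_def inj_on_def)
  have L: "card L \<le> card S"
    using S by (intro card_inj_on_le[of "\<lambda>(m, b). pt (q + m) b"]) (auto simp: L_def inj_on_def)
  have "J \<subseteq> ?Q \<times> {..<q}" by (auto simp: J_def P_def L_def)
  then have "finite J" by (rule finite_subset) simp
  then have "card {i. i < q ^ 3 \<and> src q i \<in> S \<and> dst q i \<in> S} \<le> card J"
    using q0 by (intro card_inj_on_le[of "\<lambda>i. ((i div q\<^sup>2, i div q mod q), i mod q)"])
      (auto simp: inj_on_def J_def P_def L_def src_def dst_def top_digit_less intro: digits_eq_imp_eq)
  moreover have "real (card J) \<le> (real q)\<^sup>2"
  proof -
    have S': "4 * (real (card S))\<^sup>2 \<le> real q ^ 3"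
    proof -
      have "real (4 * (card S)\<^sup>2) \<le> real (q ^ 3)" using S(2) by (simp only: of_nat_le_iff)
      then show ?thesis by simp
    qed
    have PL: "real (card P) * real (card L) \<le> (real (card S))\<^sup>2"
      using P L unfolding power2_eq_square by (intro mult_mono) auto
    have "real (card J) \<le> real (card P) * real (card L) / q + sqrt (real q * real (card P) * real (card L))"
      unfolding J_def by (rule incidence_bound[OF q]) (auto simp: P_def L_def)
    moreover have "real (card P) * real (card L) / q \<le> (real q)\<^sup>2 / 4"
    proof -
      have "real (card P) * real (card L) \<le> real q ^ 3 / 4" using PL S' by linarith
      also have "\<dots> = (real q)\<^sup>2 / 4 * real q" by (simp add: power2_eq_square power3_eq_cube)
      finally show ?thesis using q0 by (simp add: pos_divide_le_eq)
    qed
    moreover have "sqrt (real q * real (card P) * real (card L)) \<le> (real q)\<^sup>2 / 2"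
    proof (rule real_le_lsqrt)
      have "real q * (real (card P) * real (card L)) \<le> real q * (real q ^ 3 / 4)"
        using PL S' by (intro mult_left_mono) linarith+
      then show "real q * real (card P) * real (card L) \<le> ((real q)\<^sup>2 / 2)\<^sup>2"
        by (simp add: power2_eq_square power3_eq_cube mult_ac)
    qed auto
    ultimately show ?thesis using q0 zero_le_power2[of "real q"] by linarith
  qed
  then have "real (card J) \<le> real (q\<^sup>2)" by simp
  then have "card J \<le> q\<^sup>2" by (simp only: of_nat_le_iff)
  ultimately show ?thesis by linarith
qed

text \<open>All \<open>q ^ 3\<close> nontrivial objects are transported, so
  \<open>card_transported_le\<close> applies with \<open>E\<close> equal to the capacity, and the
  resulting inequality is solved for the optimum.\<close>

lemma opt_nonpreemptive_ge:
  assumes q: "prime q" and n: "q ^ 3 \<le> n" and s: "s \<ge> 1" "4 * (s + 1)\<^sup>2 \<le> q ^ 3"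
  shows "real s * (real q - 1) / 2 \<le> opt Nonpreemptive (grid_instance q n)"
proof -
  let ?I = "grid_instance q n" and ?X = "{..<q ^ 3}"
  have q0: "q > 0" using q by (rule prime_gt_0_nat)
  obtain as where as: "as \<in> tours Nonpreemptive ?I" "route_length (pt 0 0) as = opt Nonpreemptive ?I"
    using opt_attained[OF valid_grid_instance[OF q0], of Nonpreemptive n] by auto
  obtain loc loc' where conf: "initial_config ?I = (pt 0 0, loc)" "final_config ?I = (pt 0 0, loc')"
    by (simp add: initial_config_def final_config_def)
  have loc: "loc ! i = Some (fst (demands ?I ! i))" "loc' ! i = Some (snd (demands ?I ! i))"
    if "i < n" for i
    using conf that by (auto simp: initial_config_def final_config_def case_prod_beta)
  have len: "length loc = n" using conf(1) by (auto simp: initial_config_def)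
  have E: "card {i \<in> ?X. fst (demands ?I ! i) \<in> S \<and> snd (demands ?I ! i) \<in> S} \<le> q\<^sup>2"
    if S: "S \<subseteq> verts ?I" "card S \<le> s + 1" for S
  proof -
    have "finite S" using S(1) by (rule finite_subset) (simp add: grid_def)
    moreover have "4 * (card S)\<^sup>2 \<le> 4 * (s + 1)\<^sup>2" using S(2) by (intro mult_left_mono power_mono) auto
    then have "4 * (card S)\<^sup>2 \<le> q ^ 3" using s(2) by linarith
    ultimately have "card {i. i < q ^ 3 \<and> src q i \<in> S \<and> dst q i \<in> S} \<le> q\<^sup>2"
      by (rule card_demands_within_le[OF q])
    moreover have "{i \<in> ?X. fst (demands ?I ! i) \<in> S \<and> snd (demands ?I ! i) \<in> S} =
        {i. i < q ^ 3 \<and> src q i \<in> S \<and> dst q i \<in> S}"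
      using n by (auto simp: demands_grid_instance_nth)
    ultimately show ?thesis by simp
  qed
  have "real (card {i \<in> ?X. loc ! i = Some (fst (demands ?I ! i)) \<and> loc' ! i = Some (snd (demands ?I ! i))})
      \<le> real (q\<^sup>2) + route_length (pt 0 0) as / s * real (capacity ?I + q\<^sup>2)"
  proof (rule card_transported_le[where n = n])
    show "route Nonpreemptive ?I (pt 0 0, loc) as (pt 0 0, loc')"
      using as(1) conf by (simp add: tours_def)
    \<comment> \<open>The source has first coordinate below \<open>q\<close>, the destination at
      least \<open>q\<close>.\<close>
    show "fst (demands ?I ! i) \<noteq> snd (demands ?I ! i)" if "i \<in> ?X" for i
      using that n top_digit_less[of i q] by (simp add: demands_grid_instance_nth src_def dst_def)
    have "{i. i < length loc \<and> loc ! i = None} = {}" using loc len by auto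
    then show "card {i. i < length loc \<and> loc ! i = None} \<le> capacity ?I"
      by (simp only: card.empty zero_le)
  qed (use n len q0 s(1) E in \<open>auto simp: dist_grid_ge_1 pt_in_grid\<close>)
  moreover have "{i \<in> ?X. loc ! i = Some (fst (demands ?I ! i)) \<and> loc' ! i = Some (snd (demands ?I ! i))} = ?X"
    using loc n by auto
  ultimately have "real q ^ 3 \<le> (real q)\<^sup>2 + opt Nonpreemptive ?I / s * (2 * (real q)\<^sup>2)"
    using as(2) by simp
  then have "(real q)\<^sup>2 * real q \<le> (real q)\<^sup>2 * (1 + 2 * (opt Nonpreemptive ?I / s))"
    by (simp add: algebra_simps power2_eq_square power3_eq_cube)
  then have "real q \<le> 1 + 2 * (opt Nonpreemptive ?I / s)" using q0 by simp
  then show ?thesis using s(1) by (simp add: field_simps)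
qed

text \<open>Object 0 has to move, so two vertices at distance at least 1 are visited. This keeps the
  denominator of the gap away from 0.\<close>

lemma opt_preemptive_pos:
  assumes q: "q > 0" and n: "q ^ 3 \<le> n"
  shows "0 < opt Preemptive (grid_instance q n)"
proof -
  let ?I = "grid_instance q n"
  obtain as where as: "as \<in> tours Preemptive ?I" "route_length (pt 0 0) as = opt Preemptive ?I"
    using opt_attained[OF valid_grid_instance[OF q], of Preemptive n] by auto
  then have route: "route Preemptive ?I (initial_config ?I) as (final_config ?I)"
    by (simp add: tours_def)
  have "0 < q ^ 3" using q by simp
  then have n0: "0 < n" using n by linarith
  have st: "src q 0 \<noteq> dst q 0" using q by (simp add: src_def dst_def)
  have d: "demands ?I ! 0 = (src q 0, dst q 0)" using q n0 by (intro demands_grid_instance_nth) auto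
  have "src q 0 \<in> visited (pt 0 0) as" "dst q 0 \<in> visited (pt 0 0) as"
    using source_visited[OF route, of 0 "src q 0"] target_visited[OF route, of 0 "dst q 0"] st n0 d
    by (auto simp: initial_config_def final_config_def)
  then have "card {src q 0, dst q 0} \<le> card (visited (pt 0 0) as)" by (intro card_mono) auto
  then have "2 \<le> card (visited (pt 0 0) as)" using st by simp
  moreover have "real (card (visited (pt 0 0) as)) \<le> 1 + route_length (pt 0 0) as"
    using q route_Travel_verts[OF route]
    by (intro card_visited_le[where V = "grid q"]) (auto simp: pt_in_grid dist_grid_ge_1)
  ultimately show ?thesis using as(2) by linarith
qed

section \<open>The gap for a given prime, and then for all \<open>n\<close>\<close>

lemma preemption_gap_grid_instance:
  assumes q: "prime q" "q \<ge> 4" and n: "q ^ 3 \<le> n"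
  shows "sqrt (real q) / 368 \<le>
    opt Nonpreemptive (grid_instance q n) / opt Preemptive (grid_instance q n)"
proof -
  let ?N = "opt Nonpreemptive (grid_instance q n)" and ?P = "opt Preemptive (grid_instance q n)"
  have q0: "q > 0" using q by simp
  \<comment> \<open>\<open>t\<close> is \<open>q powr (3 / 2)\<close>, and \<open>s\<close> is the
    largest integer with \<open>s + 1\<close> at most \<open>t / 2\<close>, as
    \<open>opt_nonpreemptive_ge\<close> demands. From \<open>q\<close> at least 4 follows
    \<open>t\<close> at least 8, so rounding still leaves \<open>s\<close> at least
    \<open>t / 4\<close>.\<close>
  define t where "t = real q * sqrt (real q)"
  define k where "k = nat \<lfloor>t / 2\<rfloor>"
  define s where "s = k - 1"
  have "2 \<le> sqrt (real q)" using q(2) by (intro real_le_rsqrt) simp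
  then have "4 * 2 \<le> t" unfolding t_def using q(2) by (intro mult_mono) auto
  have t2: "t\<^sup>2 = real q ^ 3"
    by (simp add: t_def power_mult_distrib power2_eq_square power3_eq_cube)
  have k: "real k \<le> t / 2" "t / 2 < real k + 1"
    using \<open>4 * 2 \<le> t\<close> unfolding k_def by linarith+
  then have "k \<ge> 4" using \<open>4 * 2 \<le> t\<close> by linarith
  then have "real s = real k - 1" by (simp add: s_def)
  then have s: "s \<ge> 1" "real s + 1 \<le> t / 2" "t / 4 \<le> real s"
    using k \<open>k \<ge> 4\<close> \<open>4 * 2 \<le> t\<close> by (simp_all add: s_def)
  have "4 * (real s + 1)\<^sup>2 \<le> 4 * (t / 2)\<^sup>2" using s(2) by (intro mult_left_mono power_mono) auto
  then have "4 * (real s + 1)\<^sup>2 \<le> real q ^ 3" using t2 by (simp add: power_divide)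
  then have "real (4 * (s + 1)\<^sup>2) \<le> real (q ^ 3)" by (simp add: add.commute)
  then have "4 * (s + 1)\<^sup>2 \<le> q ^ 3" by (simp only: of_nat_le_iff)
  from opt_nonpreemptive_ge[OF q(1) n s(1) this]
  have "real s * (real q - 1) / 2 \<le> ?N" .
  moreover have "t / 4 * (real q / 2) \<le> real s * (real q - 1)"
    using s \<open>4 * 2 \<le> t\<close> q(2) by (intro mult_mono) auto
  ultimately have N: "t * real q / 16 \<le> ?N" by simp
  have P: "0 < ?P" "?P \<le> 23 * (real q)\<^sup>2"
    using opt_preemptive_pos[OF q0 n] opt_preemptive_le[OF q0 n] by auto
  \<comment> \<open>The constant is \<open>16 * 23\<close>, from the two bounds on the
    optima.\<close>
  have "sqrt (real q) / 368 = (t * real q / 16) / (23 * (real q)\<^sup>2)"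
    using q0 by (simp add: t_def power2_eq_square)
  also have "\<dots> \<le> ?N / ?P" 
  proof (rule frac_le)
    have "0 \<le> t * real q / 16" using \<open>4 * 2 \<le> t\<close> by simp
    then show "0 \<le> ?N" using N by linarith
  qed (use N P in auto)
  finally show ?thesis .
qed

theorem mainTheorem9:
  "\<exists>I :: nat \<Rightarrow> (real ^ 2) dial_a_ride.
     (\<forall>n. valid_instance (I n) \<and> length (demands (I n)) = n) \<and>
     (\<lambda>n. opt Nonpreemptive (I n) / opt Preemptive (I n))
       \<in> \<Omega>(\<lambda>n. real n powr (1 / 8) / ln (real n) ^ 3)"
proof -
  let ?good = "\<lambda>n p :: nat. prime p \<and> p ^ 3 \<le> n \<and> n \<le> p ^ 4"
  \<comment> \<open>The default 1 makes the instance valid even for those \<open>n\<close> that have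
    no suitable prime.\<close>
  define q where "q = (\<lambda>n. if \<exists>p. ?good n p then SOME p. ?good n p else 1)"
  define I where "I = (\<lambda>n. grid_instance (q n) n)"
  have good: "?good n (q n)" if "\<exists>p. ?good n p" for n
    using someI_ex[OF that] that by (simp add: q_def)
  have "q n > 0" for n
  proof (cases "\<exists>p. ?good n p")
    case True
    then show ?thesis using good[of n] prime_gt_0_nat by blast
  next
    case False
    have "q n = 1" unfolding q_def by (rule if_not_P[OF False])
    then show ?thesis by simp
  qed
  then have valid: "valid_instance (I n) \<and> length (demands (I n)) = n" for n
    by (simp add: I_def valid_grid_instance)
  have "\<forall>\<^sub>F n in sequentially. 1 / 368 * norm (real n powr (1 / 8) / ln (real n) ^ 3)
      \<le> norm (opt Nonpreemptive (I n) / opt Preemptive (I n))"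
    \<comment> \<open>\<open>256 = 4 ^ 4\<close>, so \<open>n\<close> at most \<open>q n ^ 4\<close>
      forces \<open>q n\<close> to be at least 4.\<close>
    using eventually_prime_between_roots eventually_ge_at_top[of 256]
  proof eventually_elim
    case (elim n)
    have p: "prime (q n)" "q n ^ 3 \<le> n" "n \<le> q n ^ 4" using good[OF elim(1)] by auto
    have "4 ^ 4 \<le> q n ^ 4" using p(3) elim(2) by simp
    then have q4: "q n \<ge> 4" by (simp only: power_mono_iff zero_le zero_less_numeral)
    have "exp 1 \<le> real n" using exp_le elim(2) by linarith
    then have "1 \<le> ln (real n)" using elim(2) by (subst ln_ge_iff) auto
    then have "1 \<le> ln (real n) ^ 3" by (rule one_le_power)
    \<comment> \<open>The logarithmic factor is simply dropped: the construction gives a gap of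
      order \<open>n powr (1 / 8)\<close>.\<close>
    then have "norm (real n powr (1 / 8) / ln (real n) ^ 3) \<le> real n powr (1 / 8)"
      by (simp add: divide_le_eq mult_le_cancel_left1)
    also have "\<dots> \<le> (real (q n) ^ 4) powr (1 / 8)"
    proof (rule powr_mono2)
      show "real n \<le> real (q n) ^ 4" using p(3) by (metis of_nat_le_iff of_nat_power)
    qed auto
    also have "\<dots> = (real (q n) powr 4) powr (1 / 8)" using q4 by simp
    also have "\<dots> = sqrt (real (q n))" by (simp only: powr_powr) (simp add: powr_half_sqrt)
    finally have "1 / 368 * norm (real n powr (1 / 8) / ln (real n) ^ 3) \<le> sqrt (real (q n)) / 368"
      by simp
    also have "\<dots> \<le> opt Nonpreemptive (I n) / opt Preemptive (I n)"
      unfolding I_def using preemption_gap_grid_instance[OF p(1) q4 p(2)] .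
    also have "\<dots> \<le> norm \<dots>" by (simp only: real_norm_def abs_ge_self)
    finally show ?case .
  qed
  then have "(\<lambda>n. opt Nonpreemptive (I n) / opt Preemptive (I n))
       \<in> \<Omega>(\<lambda>n. real n powr (1 / 8) / ln (real n) ^ 3)"
    by (intro landau_omega.bigI[of "1 / 368"]) auto
  then show ?thesis using valid by blast
qed

end
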